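(* Let $\mathscr{A}$ be a commutative topological ring with identity which is compact (Hausdorff) and local, and assume that its unique maximal ideal $\mathfrak{m}$ is topologically closed in $\mathscr{A}$. Let $S$ be a fixed positive integer. For each integer $N\ge S$, let $Y^{(N)}$ be a random matrix distributed according to the normalized Haar measure of the compact group $\mathrm{GL}_N(\mathscr{A})$, and let $Y^{(N)}[S]=(Y^{(N)}_{ij})_{1\le i,j\le S}$ be its upper-left $S\times S$ corner. Then, as $N\to\infty$, the probability distribution of $Y^{(N)}[S]$ converges weakly to the uniform distribution $\nu_{\mathscr{A}}^{\otimes (S\times S)}$ on $M_S(\mathscr{A})$.
   Context: A topological ring is a ring with a topology for which addition and multiplication $\mathscr{A}\times\mathscr{A}\to\mathscr{A}$ are continuous. A local ring is a ring with a unique maximal ideal; $\mathscr{A}^\times = \mathscr{A}\setminus\mathfrak{m}$ is the group of units of $\mathscr{A}$. $M_N(\mathscr{A})$ is the ring of $N\times N$ matrices over $\mathscr{A}$ with the product topology of $\mathscr{A}^{N\times N}$, and $\mathrm{GL}_N(\mathscr{A})=\{A\in M_N(\mathscr{A}) : \det A\in\mathscr{A}^\times\}$ with the subspace topology; under the stated assumptions it is a closed subset of $M_N(\mathscr{A})$ and a compact group. $\nu_{\mathscr{A}}$ is the normalized Haar measure on the compact additive group $(\mathscr{A},+)$, and $\nu_{\mathscr{A}}^{\otimes(S\times S)}$ is the corresponding product measure on $M_S(\mathscr{A})\simeq\mathscr{A}^{S\times S}$, i.e. the normalized Haar measure of the compact additive group $M_S(\mathscr{A})$. *)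

theory Defs
  imports
    "HOL-Probability.Probability"
    "HOL-Algebra.Algebraic_Closure_Type"
    "Jordan_Normal_Form.Determinant"
begin

hide_const (open) Determinants.det Finite_Cartesian_Product.mat

definition borel_on :: "'g topology \<Rightarrow> 'g measure" where
  "borel_on T = sigma (topspace T) {U. openin T U}"

(* Regularity matters: the ring is not assumed to be metrizable or second countable, and
   Haar measures and products of them are understood as regular Borel measures. *)
definition regular_borel_prob :: "'g topology \<Rightarrow> 'g measure \<Rightarrow> bool" where
  "regular_borel_prob T Q \<longleftrightarrow>
     sets Q = sets (borel_on T) \<and> prob_space Q \<and>
     (\<forall>A\<in>sets Q. emeasure Q A = (INF U\<in>{U. openin T U \<and> A \<subseteq> U}. emeasure Q U)) \<and>
     (\<forall>U. openin T U \<longrightarrow> emeasure Q U = (SUP K\<in>{K. compactin T K \<and> K \<subseteq> U}. emeasure Q K))"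

(* Intended for a group G that is a compact Hausdorff topological group in the topology T,
   with topspace T = carrier G. *)
definition normalized_haar_measure ::
    "('g, 'b) monoid_scheme \<Rightarrow> 'g topology \<Rightarrow> 'g measure \<Rightarrow> bool" where
  "normalized_haar_measure G T Q \<longleftrightarrow>
     regular_borel_prob T Q \<and>
     (\<forall>g\<in>carrier G. \<forall>A\<in>sets Q. emeasure Q ((\<lambda>x. g \<otimes>\<^bsub>G\<^esub> x) ` A) = emeasure Q A)"

definition mat_entries :: "nat \<Rightarrow> 'a mat \<Rightarrow> nat \<times> nat \<Rightarrow> 'a" where
  "mat_entries n M = (\<lambda>ij\<in>{..<n} \<times> {..<n}. M $$ ij)"

(* the product topology of 'a^(n x n), transported to n x n matrices *)
definition mat_topology :: "nat \<Rightarrow> ('a::topological_space) mat topology" where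
  "mat_topology n =
     pullback_topology (carrier_mat n n) (mat_entries n)
       (product_topology (\<lambda>_. euclidean) ({..<n} \<times> {..<n}))"

definition GL :: "nat \<Rightarrow> ('a::comm_ring_1) mat monoid" where
  "GL n = \<lparr>carrier = {M \<in> carrier_mat n n. det M dvd 1}, mult = (*), one = 1\<^sub>m n\<rparr>"

definition GL_topology :: "nat \<Rightarrow> ('a::{comm_ring_1, topological_space}) mat topology" where
  "GL_topology n = subtopology (mat_topology n) (carrier (GL n))"

(* The product measure on the n x n matrices: the library product Pi_M lives on the product
   sigma-algebra, which can be smaller than the Borel sigma-algebra of the product topology,
   so the product is the regular Borel measure that extends Pi_M. *)
definition is_mat_product_measure ::
    "nat \<Rightarrow> ('a::topological_space) measure \<Rightarrow> 'a mat measure \<Rightarrow> bool" where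
  "is_mat_product_measure n unif \<rho> \<longleftrightarrow>
     regular_borel_prob (mat_topology n) \<rho> \<and>
     distr \<rho> (\<Pi>\<^sub>M ij\<in>{..<n} \<times> {..<n}. unif) (mat_entries n) = (\<Pi>\<^sub>M ij\<in>{..<n} \<times> {..<n}. unif)"

definition corner :: "nat \<Rightarrow> 'a mat \<Rightarrow> 'a mat" where
  "corner n M = mat n n (\<lambda>ij. M $$ ij)"

definition converges_weakly ::
    "'g topology \<Rightarrow> (nat \<Rightarrow> 'g measure) \<Rightarrow> 'g measure \<Rightarrow> bool" where
  "converges_weakly T Qs Q \<longleftrightarrow>
     (\<forall>f :: 'g \<Rightarrow> real. continuous_map T euclideanreal f \<and> bounded (f ` topspace T) \<longrightarrow>
        (\<lambda>n. \<integral>x. f x \<partial>Qs n) \<longlonglongrightarrow> (\<integral>x. f x \<partial>Q))"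

end

theory Submission
  imports Defs
begin

text \<open>
  Only the left invariance of the law of \<open>Y\<close> on \<open>GL\<^sub>d\<close> is used, through row operations.  Suppose that
  modulo the maximal ideal some matrix \<open>L\<close> is a left inverse of the lower part (rows \<open>n, \<dots>, d - 1\<close>)
  of the first \<open>n\<close> columns of \<open>Y\<close>; call this part \<open>Y'\<close> and let \<open>b = L Y' \<equiv> 1\<close>.  For every \<open>n \<times> n\<close> matrix \<open>x\<close>, adding
  \<open>x L Y'\<close> to the upper rows fixes the lower rows, hence this event, and turns the corner \<open>c\<close> into
  \<open>c + x b\<close>.  Since \<open>b\<close> is invertible, averaging over uniform \<open>x\<close> shows that the corner is exactly
  uniform on the event.  The residue field is finite because the maximal ideal is open, so finitely
  many \<open>L\<close> suffice.  If no \<open>L\<close> works, some nonzero residue vector \<open>v\<close>, one of a number of vectors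
  that does not depend on \<open>d\<close>, is killed by \<open>Y'\<close>; then \<open>Y v\<close> has a unit in one of the first \<open>n\<close>
  places, and adding that row to each of the lower rows in turn yields \<open>d - n\<close> disjoint events of at
  least the same probability.  So the exceptional probability is \<open>O(1 / (d - n))\<close>.

  The ring need not be second countable, so the Borel sets of a product can exceed the product
  \<open>\<sigma>\<close>-algebra and Fubini is not available as such.  It is replaced by finite quadrature rules for
  continuous functions that are uniform in a compact parameter.
\<close>

section \<open>Quadrature for continuous functions on compact spaces\<close>

text \<open>A \<sigma>-algebra that contains a base of the topology need not contain every open set.
  The product \<sigma>-algebra, with the open boxes as base, is the case in point.\<close>

definition measurable_open_base :: "'g topology \<Rightarrow> 'g measure \<Rightarrow> bool" where
  "measurable_open_base T M \<longleftrightarrow>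
     space M = topspace T \<and>
     (\<forall>U x. openin T U \<and> x \<in> U \<longrightarrow> (\<exists>V\<in>sets M. openin T V \<and> x \<in> V \<and> V \<subseteq> U))"

lemma measurable_open_baseE:
  assumes "measurable_open_base T M" "openin T U" "x \<in> U"
  obtains V where "V \<in> sets M" "openin T V" "x \<in> V" "V \<subseteq> U"
  using assms unfolding measurable_open_base_def by blast

lemma measurable_nbhd_of_compactin:
  assumes base: "measurable_open_base T M" and C: "compactin T C" and U: "openin T U" "C \<subseteq> U"
  obtains V where "V \<in> sets M" "C \<subseteq> V" "V \<subseteq> U"
proof -
  have "\<exists>V. V \<in> sets M \<and> openin T V \<and> x \<in> V \<and> V \<subseteq> U" if "x \<in> C" for x
    by (rule measurable_open_baseE[OF base U(1) subsetD[OF U(2) that]]) blast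
  then obtain V where V: "\<And>x. x \<in> C \<Longrightarrow> V x \<in> sets M \<and> openin T (V x) \<and> x \<in> V x \<and> V x \<subseteq> U"
    by metis
  have "\<exists>F. finite F \<and> F \<subseteq> V ` C \<and> C \<subseteq> \<Union>F"
    using compactinD[OF C, of "V ` C"] V by blast
  then obtain D where D: "finite D" "D \<subseteq> C" "C \<subseteq> \<Union>(V ` D)"
    by (metis finite_subset_image)
  show thesis
    by (rule that[of "\<Union>(V ` D)"]) (use D V in \<open>auto intro!: sets.finite_UN\<close>)
qed

text \<open>The set \<open>{f > a}\<close> may be an uncountable union of basic open sets. It is
  also the countable union of the compact sets \<open>{f \<ge> a + 1 / (n + 1)}\<close>, and between
  each of these and \<open>{f > a}\<close> there is a measurable set.\<close>

lemma borel_measurable_of_continuous_map: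
  fixes f :: "'g \<Rightarrow> real"
  assumes base: "measurable_open_base T M" and T: "compact_space T"
    and f: "continuous_map T euclideanreal f"
  shows "f \<in> borel_measurable M"
proof (unfold borel_measurable_iff_greater, intro allI)
  fix a :: real
  let ?U = "{x \<in> topspace T. f x \<in> {a<..}}"
  have U: "openin T ?U"
    by (rule openin_continuous_map_preimage[OF f]) simp
  have "\<exists>V. V \<in> sets M \<and> {x \<in> topspace T. f x \<in> {a + 1 / real (Suc n)..}} \<subseteq> V \<and> V \<subseteq> ?U" for n
  proof -
    have "closedin T {x \<in> topspace T. f x \<in> {a + 1 / real (Suc n)..}}"
      by (rule closedin_continuous_map_preimage[OF f]) simp
    then have "compactin T {x \<in> topspace T. f x \<in> {a + 1 / real (Suc n)..}}"
      using T closedin_compact_space by blast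
    moreover have "{x \<in> topspace T. f x \<in> {a + 1 / real (Suc n)..}} \<subseteq> ?U"
    proof
      fix x assume "x \<in> {x \<in> topspace T. f x \<in> {a + 1 / real (Suc n)..}}"
      moreover have "a < a + 1 / real (Suc n)" by simp
      ultimately have "x \<in> topspace T" "a < f x"
        using less_le_trans[of a "a + 1 / real (Suc n)" "f x"] by simp_all
      then show "x \<in> ?U" by simp
    qed
    ultimately obtain V where "V \<in> sets M" "{x \<in> topspace T. f x \<in> {a + 1 / real (Suc n)..}} \<subseteq> V" "V \<subseteq> ?U"
      by (rule measurable_nbhd_of_compactin[OF base _ U])
    then show ?thesis by blast
  qed
  then have "\<exists>V. \<forall>n. V n \<in> sets M \<and> {x \<in> topspace T. f x \<in> {a + 1 / real (Suc n)..}} \<subseteq> V n \<and> V n \<subseteq> ?U"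
    by (intro choice) blast
  then obtain V where V: "\<And>n. V n \<in> sets M" "\<And>n. {x \<in> topspace T. f x \<in> {a + 1 / real (Suc n)..}} \<subseteq> V n"
      "\<And>n. V n \<subseteq> ?U"
    by blast
  have "?U \<subseteq> (\<Union>n. V n)"
  proof
    fix x assume x: "x \<in> ?U"
    then have "f x - a > 0" by simp
    then obtain n where "inverse (real (Suc n)) < f x - a"
      using reals_Archimedean by blast
    with x have "x \<in> {x \<in> topspace T. f x \<in> {a + 1 / real (Suc n)..}}"
      by (simp add: inverse_eq_divide)
    with V(2)[of n] show "x \<in> (\<Union>n. V n)" by blast
  qed
  with V(3) have "?U = (\<Union>n. V n)" by blast
  moreover have "{w \<in> space M. a < f w} = ?U"
    using base by (auto simp: measurable_open_base_def)
  ultimately show "{w \<in> space M. a < f w} \<in> sets M"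
    using V(1) by auto
qed

lemma bounded_of_continuous_map:
  fixes f :: "'g \<Rightarrow> real"
  assumes "compact_space T" "continuous_map T euclideanreal f"
  shows "bounded (f ` topspace T)"
  using image_compactin[OF _ assms(2), of "topspace T"] assms(1)
  by (simp add: compact_space_def compact_imp_bounded)

lemma integrable_of_continuous_map:
  fixes f :: "'g \<Rightarrow> real"
  assumes base: "measurable_open_base T M" and T: "compact_space T" and M: "finite_measure M"
    and f: "continuous_map T euclideanreal f"
  shows "integrable M f"
proof -
  obtain B where "\<And>x. x \<in> topspace T \<Longrightarrow> norm (f x) \<le> B"
    using bounded_of_continuous_map[OF T f] by (auto simp: bounded_iff)
  then show ?thesis
    using base by (intro finite_measure.integrable_const_bound[OF M, of _ B]
        borel_measurable_of_continuous_map[OF base T f]) (auto simp: measurable_open_base_def)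
qed

section \<open>Quadrature uniform in a compact parameter, and exchange of integrals\<close>

lemma continuous_map_slice:
  assumes h: "continuous_map (prod_topology T K) Z (\<lambda>(x, y). h x y)"
  shows "y \<in> topspace K \<Longrightarrow> continuous_map T Z (\<lambda>x. h x y)"
    and "x \<in> topspace T \<Longrightarrow> continuous_map K Z (h x)"
proof -
  assume "y \<in> topspace K"
  then have "continuous_map T (prod_topology T K) (\<lambda>x. (x, y))"
    by (simp add: continuous_map_pairwise o_def)
  from continuous_map_compose[OF this h] show "continuous_map T Z (\<lambda>x. h x y)"
    by (simp add: o_def)
next
  assume "x \<in> topspace T"
  then have "continuous_map K (prod_topology T K) (\<lambda>y. (x, y))"
    by (simp add: continuous_map_pairwise o_def)
  from continuous_map_compose[OF this h] show "continuous_map K Z (h x)"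
    by (simp add: o_def)
qed

text \<open>Tube lemma: the pairs \<open>(x', y)\<close> at which \<open>h\<close> is
  \<open>e\<close>-close to \<open>h x y\<close> form an open set that contains
  \<open>{x} \<times> K\<close>, and compactness of \<open>K\<close> gives one neighbourhood of
  \<open>x\<close> that serves all \<open>y\<close>.\<close>

lemma uniform_oscillation_nbhd:
  fixes h :: "'g \<Rightarrow> 'k \<Rightarrow> real"
  assumes base: "measurable_open_base T M" and K: "compact_space K"
    and h: "continuous_map (prod_topology T K) euclideanreal (\<lambda>(x, y). h x y)"
    and e: "e > 0" and x: "x \<in> topspace T"
  obtains V where "V \<in> sets M" "openin T V" "x \<in> V" "\<And>x' y. x' \<in> V \<Longrightarrow> y \<in> topspace K \<Longrightarrow> \<bar>h x y - h x' y\<bar> < e"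
proof -
  let ?W = "{z \<in> topspace (prod_topology T K). h x (snd z) - (case z of (x', y) \<Rightarrow> h x' y) \<in> {-e<..<e}}"
  have "continuous_map (prod_topology T K) euclideanreal (\<lambda>z. h x (snd z))"
    using continuous_map_compose[OF continuous_map_snd continuous_map_slice(2)[OF h x]]
    by (simp add: o_def)
  then have "continuous_map (prod_topology T K) euclideanreal (\<lambda>z. h x (snd z) - (case z of (x', y) \<Rightarrow> h x' y))"
    by (intro continuous_map_diff h)
  then have "openin (prod_topology T K) ?W"
    by (rule openin_continuous_map_preimage) simp
  moreover have "{x} \<times> topspace K \<subseteq> ?W"
    using x e by auto
  ultimately obtain U U' where U: "openin T U" "x \<in> U" "topspace K \<subseteq> U'" "U \<times> U' \<subseteq> ?W"
    using tube_lemma_right[of T K ?W "topspace K" x] K[unfolded compact_space_def] x by blast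
  obtain V where V: "V \<in> sets M" "openin T V" "x \<in> V" "V \<subseteq> U"
    by (rule measurable_open_baseE[OF base U(1,2)])
  show thesis
  proof (rule that[OF V(1-3)])
    fix x' y assume "x' \<in> V" "y \<in> topspace K"
    then have "(x', y) \<in> ?W"
      using U V by blast
    then show "\<bar>h x y - h x' y\<bar> < e" by auto
  qed
qed

text \<open>Finitely many measurable neighbourhoods of small oscillation cover \<open>T\<close>.
  Their centres are the nodes, and after they are made disjoint their measures are the weights. One
  rule serves all \<open>y\<close>, since the oscillation is small uniformly in
  \<open>y\<close>.\<close>

lemma uniform_quadrature:
  fixes h :: "'g \<Rightarrow> 'k \<Rightarrow> real"
  assumes base: "measurable_open_base T M" and T: "compact_space T" and K: "compact_space K"
    and M: "prob_space M"
    and h: "continuous_map (prod_topology T K) euclideanreal (\<lambda>(x, y). h x y)"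
    and e: "e > 0"
  obtains A :: "nat set" and w :: "nat \<Rightarrow> real" and p :: "nat \<Rightarrow> 'g"
  where "finite A" "\<And>i. i \<in> A \<Longrightarrow> p i \<in> topspace T" "\<And>i. i \<in> A \<Longrightarrow> 0 \<le> w i" "sum w A = 1"
    "\<And>y. y \<in> topspace K \<Longrightarrow> \<bar>(\<Sum>i\<in>A. w i * h (p i) y) - (\<integral>x. h x y \<partial>M)\<bar> \<le> e"
proof -
  interpret prob_space M by fact
  have space: "space M = topspace T"
    using base by (simp add: measurable_open_base_def)
  have "\<exists>V. V \<in> sets M \<and> openin T V \<and> x \<in> V \<and> (\<forall>x'\<in>V. \<forall>y\<in>topspace K. \<bar>h x y - h x' y\<bar> < e)"
    if "x \<in> topspace T" for x
    by (rule uniform_oscillation_nbhd[OF base K h e that]) blast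
  then have "\<exists>V. \<forall>x\<in>topspace T. V x \<in> sets M \<and> openin T (V x) \<and> x \<in> V x \<and>
      (\<forall>x'\<in>V x. \<forall>y\<in>topspace K. \<bar>h x y - h x' y\<bar> < e)"
    by (intro bchoice) blast
  then obtain V where V: "\<And>x. x \<in> topspace T \<Longrightarrow> V x \<in> sets M \<and> openin T (V x) \<and> x \<in> V x \<and>
      (\<forall>x'\<in>V x. \<forall>y\<in>topspace K. \<bar>h x y - h x' y\<bar> < e)"
    by blast
  have "\<exists>F. finite F \<and> F \<subseteq> V ` topspace T \<and> topspace T \<subseteq> \<Union>F"
    using compactinD[of T "topspace T" "V ` topspace T"] V T by (auto simp: compact_space_def)
  then obtain D where D: "finite D" "D \<subseteq> topspace T" "topspace T \<subseteq> \<Union>(V ` D)"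
    by (metis finite_subset_image)
  obtain p and n :: nat where p: "D = p ` {i. i < n}"
    using finite_imp_nat_seg_image_inj_on[OF D(1)] by auto
  let ?A = "{i. i < n}"
  \<comment> \<open>The node \<open>p i\<close> need not lie in \<open>E i\<close>; the estimate
    uses only that \<open>E i\<close> is contained in the neighbourhood of
    \<open>p i\<close>.\<close>
  define E where "E i = V (p i) - (\<Union>j<i. V (p j))" for i
  have pT: "p i \<in> topspace T" if "i < n" for i
    using D(2) p that by auto
  have E: "E i \<in> sets M" if "i < n" for i
    using V pT that unfolding E_def by (intro sets.Diff sets.finite_UN) auto
  have E_cover: "\<exists>i<n. x \<in> E i" if x: "x \<in> topspace T" for x
  proof -
    have "\<exists>i. i < n \<and> x \<in> V (p i)"
      using D(3) p x by auto
    then obtain i where "i < n" "x \<in> V (p i)" "\<And>j. j < i \<Longrightarrow> x \<notin> V (p j)"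
      using exists_least_iff[of "\<lambda>i. i < n \<and> x \<in> V (p i)"] less_trans by blast
    then show ?thesis
      unfolding E_def by auto
  qed
  have E_disjoint: "j = i" if "x \<in> E i" "x \<in> E j" for x i j
    using that by (cases j i rule: linorder_cases) (auto simp: E_def)
  \<comment> \<open>The step function with value \<open>c i\<close> on \<open>E i\<close>. The
    choice \<open>c i = 1\<close> shows that the weights add up to 1, and
    \<open>c i = h (p i) y\<close> approximates \<open>h\<close> up to \<open>e\<close>.\<close>
  define s where "s c x = (\<Sum>i\<in>?A. indicator (E i) x * c i)" for c :: "nat \<Rightarrow> real" and x
  have s_eq: "s c x = c i" if "i < n" "x \<in> E i" for c x i
  proof -
    have "indicator (E j) x * c j = (if j = i then c j else 0)" for j
      using E_disjoint[OF that(2), of j] that(2) by (cases "j = i") (auto simp: indicator_def)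
    then show ?thesis
      using that(1) by (simp add: s_def)
  qed
  have ible: "integrable M (s c)" and int: "(\<integral>x. s c x \<partial>M) = (\<Sum>i\<in>?A. measure M (E i) * c i)" for c
  proof -
    have i: "integrable M (\<lambda>x. indicator (E i) x * c i)" if "i \<in> ?A" for i
      using E that by (intro integrable_mult_left integrable_real_indicator) (auto simp: less_top[symmetric])
    then show "integrable M (s c)"
      unfolding s_def by (rule Bochner_Integration.integrable_sum)
    have "(\<integral>x. indicator (E i) x * c i \<partial>M) = measure M (E i) * c i" if "i \<in> ?A" for i
      using E that sets.sets_into_space[of "E i" M] by (simp add: Int_absorb2)
    then show "(\<integral>x. s c x \<partial>M) = (\<Sum>i\<in>?A. measure M (E i) * c i)"
      unfolding s_def using i by (simp only: Bochner_Integration.integral_sum cong: sum.cong)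
  qed
  show thesis
  proof (rule that[of ?A p "\<lambda>i. measure M (E i)"])
    have "s (\<lambda>_. 1) x = 1" if "x \<in> topspace T" for x
      using E_cover[OF that] s_eq by blast
    then have "(\<integral>x. s (\<lambda>_. 1) x \<partial>M) = (\<integral>x. 1 \<partial>M)"
      by (intro Bochner_Integration.integral_cong) (simp_all add: space)
    then show "(\<Sum>i\<in>?A. measure M (E i)) = 1"
      unfolding int by (simp add: prob_space)
  next
    fix y assume y: "y \<in> topspace K"
    let ?s = "s (\<lambda>i. h (p i) y)"
    have hi: "integrable M (\<lambda>x. h x y)"
      by (rule integrable_of_continuous_map[OF base T finite_measure_axioms continuous_map_slice(1)[OF h y]])
    have "\<bar>?s x - h x y\<bar> \<le> e" if x: "x \<in> topspace T" for x
    proof -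
      obtain i where i: "i < n" "x \<in> E i"
        using E_cover[OF x] by blast
      then have "x \<in> V (p i)"
        by (simp add: E_def)
      then have "\<bar>h (p i) y - h x y\<bar> < e"
        using V[OF pT[OF i(1)]] y by blast
      then show ?thesis
        using s_eq[OF i, of "\<lambda>i. h (p i) y"] by linarith
    qed
    then have "(\<integral>x. \<bar>?s x - h x y\<bar> \<partial>M) \<le> (\<integral>x. e \<partial>M)"
      using ible hi by (intro integral_mono) (auto simp: space)
    moreover have "\<bar>\<integral>x. ?s x - h x y \<partial>M\<bar> \<le> (\<integral>x. \<bar>?s x - h x y\<bar> \<partial>M)"
      by (rule integral_abs_bound)
    ultimately have "\<bar>\<integral>x. ?s x - h x y \<partial>M\<bar> \<le> (\<integral>x. e \<partial>M)"
      by linarith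
    then have "\<bar>\<integral>x. ?s x - h x y \<partial>M\<bar> \<le> e"
      by (simp add: prob_space)
    then show "\<bar>(\<Sum>i\<in>?A. measure M (E i) * h (p i) y) - (\<integral>x. h x y \<partial>M)\<bar> \<le> e"
      unfolding int[symmetric] using ible hi by (simp add: Bochner_Integration.integral_diff)
  next
    show "finite ?A" by simp
    show "p i \<in> topspace T" if "i \<in> ?A" for i
      using pT that by simp
    show "0 \<le> measure M (E i)" for i by simp
  qed
qed

lemma nonpos_of_le_mult_epsilon:
  fixes b G :: real
  assumes bound: "\<And>e. e > 0 \<Longrightarrow> b \<le> G * e" and G: "0 \<le> G"
  shows "b \<le> 0"
proof (rule field_le_epsilon)
  fix e :: real assume e: "e > 0"
  \<comment> \<open>The divisor is \<open>G + 1\<close> because \<open>G\<close> may be 0.\<close>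
  have pos: "0 < e / (G + 1)"
    using e G by (intro divide_pos_pos) linarith+
  have "G * (e / (G + 1)) \<le> (G + 1) * (e / (G + 1))"
    using pos by (intro mult_right_mono) linarith+
  also have "\<dots> = e"
    using G by simp
  finally show "b \<le> 0 + e"
    using bound[OF pos] by linarith
qed

text \<open>A substitute for Fubini, evaluating the double integral of
  \<open>g \<omega> * h x (\<tau> \<omega>)\<close> in both orders: over \<omega> first it is
  \<open>a\<close> for every \<open>x\<close>; over \<open>x\<close> first it is
  \<open>g \<omega> * b\<close>. Joint measurability is avoided by replacing the integral over
  \<open>x\<close> by a finite weighted sum whose error \<open>e\<close> is uniform in \<omega>;
  then \<open>e\<close> tends to 0.\<close>

lemma integral_exchange:
  fixes h :: "'g \<Rightarrow> 'k \<Rightarrow> real" and g :: "'w \<Rightarrow> real"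
  assumes base: "measurable_open_base T M" and T: "compact_space T" and K: "compact_space K"
    and M: "prob_space M"
    and h: "continuous_map (prod_topology T K) euclideanreal (\<lambda>(x, y). h x y)"
    and \<tau>: "\<And>\<omega>. \<omega> \<in> space Q \<Longrightarrow> \<tau> \<omega> \<in> topspace K"
    and g: "integrable Q g"
    and int: "\<And>x. x \<in> topspace T \<Longrightarrow> integrable Q (\<lambda>\<omega>. g \<omega> * h x (\<tau> \<omega>))"
    and a: "\<And>x. x \<in> topspace T \<Longrightarrow> (\<integral>\<omega>. g \<omega> * h x (\<tau> \<omega>) \<partial>Q) = a"
    and b: "\<And>\<omega>. \<omega> \<in> space Q \<Longrightarrow> g \<omega> \<noteq> 0 \<Longrightarrow> (\<integral>x. h x (\<tau> \<omega>) \<partial>M) = b"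
  shows "a = (\<integral>\<omega>. g \<omega> \<partial>Q) * b"
proof -
  define G where "G = (\<integral>\<omega>. \<bar>g \<omega>\<bar> \<partial>Q)"
  have G: "0 \<le> G" by (simp add: G_def)
  have bound: "\<bar>a - (\<integral>\<omega>. g \<omega> \<partial>Q) * b\<bar> \<le> G * e" if e: "e > 0" for e
  proof (rule uniform_quadrature[OF base T K M h e])
    fix A :: "nat set" and p :: "nat \<Rightarrow> 'g" and w :: "nat \<Rightarrow> real"
    assume A: "finite A" "\<And>i. i \<in> A \<Longrightarrow> p i \<in> topspace T" "\<And>i. i \<in> A \<Longrightarrow> 0 \<le> w i" "sum w A = 1"
      and q: "\<And>y. y \<in> topspace K \<Longrightarrow> \<bar>(\<Sum>i\<in>A. w i * h (p i) y) - (\<integral>x. h x y \<partial>M)\<bar> \<le> e"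
    \<comment> \<open>The weighted sum over the nodes has integral exactly \<open>a\<close>, because
      the weights add up to 1, and differs pointwise from \<open>g \<omega> * b\<close> by at most
      \<open>\<bar>g \<omega>\<bar> * e\<close>.\<close>
    let ?s = "\<lambda>\<omega>. \<Sum>i\<in>A. w i * (g \<omega> * h (p i) (\<tau> \<omega>))"
    have si: "integrable Q ?s"
      using int[OF A(2)] by (intro Bochner_Integration.integrable_sum integrable_mult_right)
    have "(\<integral>\<omega>. ?s \<omega> \<partial>Q) = (\<Sum>i\<in>A. w i * a)"
      using int[OF A(2)] a[OF A(2)] by (simp only: Bochner_Integration.integral_sum integrable_mult_right integral_mult_right_zero cong: sum.cong)
    then have s: "(\<integral>\<omega>. ?s \<omega> \<partial>Q) = a"
      using A(4) by (simp add: sum_distrib_right[symmetric])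
    have "\<bar>?s \<omega> - g \<omega> * b\<bar> \<le> \<bar>g \<omega>\<bar> * e" if \<omega>: "\<omega> \<in> space Q" for \<omega>
    proof (cases "g \<omega> = 0")
      case False
      have "?s \<omega> - g \<omega> * b = g \<omega> * ((\<Sum>i\<in>A. w i * h (p i) (\<tau> \<omega>)) - b)"
        by (simp add: sum_distrib_left right_diff_distrib mult_ac)
      then show ?thesis
        using q[OF \<tau>[OF \<omega>]] b[OF \<omega> False] by (simp add: abs_mult mult_left_mono)
    qed simp
    then have "(\<integral>\<omega>. \<bar>?s \<omega> - g \<omega> * b\<bar> \<partial>Q) \<le> (\<integral>\<omega>. \<bar>g \<omega>\<bar> * e \<partial>Q)"
      using si g by (intro integral_mono) auto
    moreover have "\<bar>\<integral>\<omega>. ?s \<omega> - g \<omega> * b \<partial>Q\<bar> \<le> (\<integral>\<omega>. \<bar>?s \<omega> - g \<omega> * b\<bar> \<partial>Q)"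
      by (rule integral_abs_bound)
    ultimately show ?thesis
      using si g s by (simp add: G_def Bochner_Integration.integral_diff)
  qed
  have "\<bar>a - (\<integral>\<omega>. g \<omega> \<partial>Q) * b\<bar> \<le> 0"
    using bound G by (rule nonpos_of_le_mult_epsilon)
  then show ?thesis by simp
qed

section \<open>Compact local rings\<close>

text \<open>Zorn's lemma for the ideals that contain \<open>a\<close> but not \<open>\<one>\<close>;
  the principal ideal of the nonunit \<open>a\<close> is one of them. A larger ideal either avoids
  \<open>\<one>\<close> and equals \<open>M\<close>, or contains \<open>\<one>\<close> and is the
  whole ring.\<close>

lemma (in cring) ex_maximalideal_containing:
  assumes a: "a \<in> carrier R" "a \<notin> Units R"
  obtains M where "maximalideal M R" "a \<in> M"
proof -
  let ?F = "{J. ideal J R \<and> a \<in> J \<and> \<one> \<notin> J}"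
  have "\<one> \<notin> PIdl a"
  proof
    assume "\<one> \<in> PIdl a"
    then obtain b where "b \<in> carrier R" "\<one> = b \<otimes> a"
      by (auto simp: cgenideal_def)
    with a show False
      by (auto simp: Units_def m_comm)
  qed
  then have "PIdl a \<in> ?F"
    using a by (auto intro: cgenideal_ideal cgenideal_self)
  moreover have "\<Union>C \<in> ?F" if C: "C \<noteq> {}" "subset.chain ?F C" for C
  proof -
    have "subset.chain {J. ideal J R} C"
      using C(2) by (auto simp: pred_on.chain_def)
    from chain_Union_is_ideal[OF this] C show ?thesis
      by (auto simp: pred_on.chain_def)
  qed
  ultimately have "\<exists>M\<in>?F. \<forall>J\<in>?F. M \<subseteq> J \<longrightarrow> J = M"
    by (intro subset_Zorn_nonempty) blast+
  then obtain M where M: "ideal M R" "a \<in> M" "\<one> \<notin> M"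
    and max: "\<And>J. ideal J R \<Longrightarrow> a \<in> J \<Longrightarrow> \<one> \<notin> J \<Longrightarrow> M \<subseteq> J \<Longrightarrow> J = M"
    by blast
  have "maximalideal M R"
  proof (rule maximalidealI[OF M(1)])
    show "carrier R \<noteq> M"
      using M(3) by auto
    show "J = M \<or> J = carrier R" if "ideal J R" "M \<subseteq> J" for J
      using that M max ideal.one_imp_carrier[OF that(1)] by blast
  qed
  with M(2) show thesis by (rule that[rotated])
qed

section \<open>Left inverses over a local ring\<close>

text \<open>For a maximal ideal \<open>m\<close> the last hypothesis says that the columns of
  \<open>A\<close> are linearly independent over the residue field. Columns are added one at a time:
  a row that kills the old columns and takes the value 1 on the new one corrects the left inverse
  found so far.\<close>

lemma left_inverse_of_unimodular:
  fixes m :: "'a::comm_ring_1 set" and A :: "'i \<Rightarrow> nat \<Rightarrow> 'a"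
  assumes unit: "\<And>a. a \<notin> m \<Longrightarrow> a dvd 1" and zero: "0 \<in> m" and one: "1 \<notin> m" and J: "finite J"
    and A: "\<And>c. (\<exists>j<k. c j \<notin> m) \<Longrightarrow> \<exists>t\<in>J. (\<Sum>j<k. A t j * c j) \<notin> m"
  shows "\<exists>L. \<forall>i<k. \<forall>j<k. (\<Sum>t\<in>J. L i t * A t j) = (if i = j then 1 else 0)"
  using A
proof (induction k)
  case 0
  then show ?case by simp
next
  case (Suc k)
  have "\<exists>t\<in>J. (\<Sum>j<k. A t j * c j) \<notin> m" if c: "\<exists>j<k. c j \<notin> m" for c
  proof -
    have "\<exists>j<Suc k. (c(k := 0)) j \<notin> m"
      using c by (metis fun_upd_other less_Suc_eq less_irrefl)
    from Suc.prems[OF this] show ?thesis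
      by (simp add: lessThan_Suc)
  qed
  from Suc.IH[OF this] obtain L
    where L: "\<And>i j. i < k \<Longrightarrow> j < k \<Longrightarrow> (\<Sum>t\<in>J. L i t * A t j) = (if i = j then 1 else 0)"
    by blast
  \<comment> \<open>\<open>A\<close> applied to \<open>c = (-v, 1)\<close> is the new column minus
    the combination of old columns with coefficients \<open>v = L A_k\<close>. By hypothesis one of
    its entries, at \<open>s\<close>, is a unit.\<close>
  define v where "v i = (\<Sum>t\<in>J. L i t * A t k)" for i
  define c where "c j = (if j < k then - v j else 1)" for j
  have "\<exists>j<Suc k. c j \<notin> m"
    using one by (intro exI[of _ k]) (simp add: c_def)
  from Suc.prems[OF this] obtain s where s: "s \<in> J" "(\<Sum>j<Suc k. A s j * c j) \<notin> m"
    by blast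
  have w: "(\<Sum>j<Suc k. A s j * c j) = A s k - (\<Sum>j<k. A s j * v j)"
    by (simp add: c_def sum_negf)
  obtain u where u: "u * (A s k - (\<Sum>j<k. A s j * v j)) = 1"
    using unit[OF s(2)] unfolding w dvd_def by (metis mult.commute)
  \<comment> \<open>Row \<open>s\<close> of \<open>1 - A L\<close>, scaled by \<open>u\<close>. It
    kills the first \<open>k\<close> columns because \<open>L\<close> is a left inverse of them, and
    the scaling makes its value on column \<open>k\<close> equal to 1.\<close>
  define l where "l t = u * ((if t = s then 1 else 0) - (\<Sum>i<k. A s i * L i t))" for t
  have l: "(\<Sum>t\<in>J. l t * A t j) = u * (A s j - (\<Sum>i<k. A s i * (\<Sum>t\<in>J. L i t * A t j)))" for j
  proof -
    have swap: "(\<Sum>t\<in>J. \<Sum>i<k. A s i * (L i t * A t j)) = (\<Sum>i<k. A s i * (\<Sum>t\<in>J. L i t * A t j))"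
      by (subst sum.swap) (simp add: sum_distrib_left)
    have "(\<Sum>t\<in>J. l t * A t j) =
        (\<Sum>t\<in>J. u * ((if t = s then A t j else 0) - (\<Sum>i<k. A s i * (L i t * A t j))))"
      unfolding l_def by (intro sum.cong) (auto simp: algebra_simps sum_distrib_left sum_distrib_right)
    also have "\<dots> = u * ((\<Sum>t\<in>J. if t = s then A t j else 0) - (\<Sum>i<k. A s i * (\<Sum>t\<in>J. L i t * A t j)))"
      by (simp only: sum_distrib_left[symmetric, of u] sum_subtractf swap)
    finally show ?thesis
      using s(1) J by simp
  qed
  have l_less: "(\<Sum>t\<in>J. l t * A t j) = 0" if "j < k" for j
  proof -
    have "(\<Sum>i<k. A s i * (\<Sum>t\<in>J. L i t * A t j)) = (\<Sum>i<k. if i = j then A s i else 0)"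
      using that by (intro sum.cong) (auto simp: L)
    then show ?thesis
      using that by (simp add: l)
  qed
  have l_eq: "(\<Sum>t\<in>J. l t * A t k) = 1"
    unfolding l v_def[symmetric] by (rule u)
  \<comment> \<open>Subtracting \<open>v i * l\<close> removes the value \<open>v i\<close> of row
    \<open>i\<close> on the new column and changes nothing on the old ones; \<open>l\<close> itself
    becomes the last row.\<close>
  define L' where "L' i t = (if i < k then L i t - v i * l t else l t)" for i t
  have L': "(\<Sum>t\<in>J. L' i t * A t j) = (\<Sum>t\<in>J. L i t * A t j) - v i * (\<Sum>t\<in>J. l t * A t j)" if "i < k" for i j
    using that by (simp add: L'_def algebra_simps sum_subtractf sum_distrib_left)
  have "(\<Sum>t\<in>J. L' i t * A t j) = (if i = j then 1 else 0)" if "i < Suc k" "j < Suc k" for i j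
  proof (cases "i < k")
    case True
    then show ?thesis
      using that by (cases "j < k") (simp_all add: L' L l_less l_eq v_def[symmetric] less_Suc_eq)
  next
    case False
    with that have "i = k" by simp
    then show ?thesis
      using that by (cases "j < k") (simp_all add: L'_def l_less l_eq less_Suc_eq)
  qed
  then show ?case by blast
qed

section \<open>Openness of the maximal ideal and finiteness of the residue field\<close>

locale compact_local_ring =
  fixes m :: "'a::{comm_ring_1, t2_space, topological_monoid_add, topological_semigroup_mult} set"
  assumes compact: "compact (UNIV :: 'a set)"
    and closed: "closed m"
    and zero_mem: "0 \<in> m"
    and add_mem: "\<And>a b. a \<in> m \<Longrightarrow> b \<in> m \<Longrightarrow> a + b \<in> m"
    and mult_mem: "\<And>a b. b \<in> m \<Longrightarrow> a * b \<in> m"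
    and one_not_mem: "1 \<notin> m"
    and unit: "\<And>a. a \<notin> m \<Longrightarrow> a dvd 1"
begin

lemma uminus_mem: "a \<in> m \<Longrightarrow> - a \<in> m"
  using mult_mem[of a "-1"] by simp

lemma diff_mem: "a \<in> m \<Longrightarrow> b \<in> m \<Longrightarrow> a - b \<in> m"
  using add_mem[of a "- b"] uminus_mem by simp

lemma sum_mem: "(\<And>i. i \<in> A \<Longrightarrow> f i \<in> m) \<Longrightarrow> sum f A \<in> m"
  by (induction A rule: infinite_finite_induct) (auto simp: zero_mem add_mem)

lemma mem_cong:
  assumes "a - b \<in> m"
  shows "a \<in> m \<longleftrightarrow> b \<in> m"
proof
  show "a \<in> m" if "b \<in> m"
    using add_mem[OF assms that] by simp
  show "b \<in> m" if "a \<in> m"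
    using diff_mem[OF that assms] by simp
qed

text \<open>The type classes speak of the continuity of addition and multiplication; subtracting a
  constant is adding its negative.\<close>

lemma continuous_on_minus_const [continuous_intros]:
  fixes f :: "'b::topological_space \<Rightarrow> 'a"
  assumes "continuous_on A f"
  shows "continuous_on A (\<lambda>x. f x - a)"
  using continuous_on_add[OF assms continuous_on_const[of A "- a"]] by simp

text \<open>The set \<open>?W\<close> is open since \<open>m\<close> is closed, and it contains
  \<open>{0} \<times> UNIV\<close>. By compactness a neighbourhood \<open>V\<close> of 0 satisfies
  \<open>v * b - 1 \<notin> m\<close> for all \<open>v\<close> in \<open>V\<close> and all
  \<open>b\<close>, so no element of \<open>V\<close> has an inverse and
  \<open>V \<subseteq> m\<close>. Translates of \<open>V\<close> then show that \<open>m\<close> is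
  open.\<close>

lemma open_ideal: "open m"
proof -
  let ?W = "{z :: 'a \<times> 'a. fst z * snd z - 1 \<notin> m}"
  have "continuous_on UNIV (\<lambda>z :: 'a \<times> 'a. fst z * snd z - 1)"
    by (intro continuous_intros)
  then have "open ((\<lambda>z :: 'a \<times> 'a. fst z * snd z - 1) -` (- m))"
    using closed by (intro open_vimage) auto
  moreover have "(\<lambda>z :: 'a \<times> 'a. fst z * snd z - 1) -` (- m) = ?W"
    by auto
  ultimately have "open ?W" by simp
  moreover have "{0} \<times> UNIV \<subseteq> ?W"
    using uminus_mem[of "-1"] one_not_mem by auto
  ultimately obtain V where V: "0 \<in> V" "open V" "V \<times> UNIV \<subseteq> ?W"
    using Elementary_Topology.tube_lemma[OF compact, of ?W 0] by blast
  have Vm: "v \<in> m" if "v \<in> V" for v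
  proof (rule ccontr)
    assume "v \<notin> m"
    then obtain b where "v * b = 1"
      using unit unfolding dvd_def by metis
    moreover have "(v, b) \<in> ?W"
      using V(3) that by blast
    ultimately show False
      using zero_mem by simp
  qed
  show ?thesis
  proof (subst open_subopen, intro ballI)
    fix a assume a: "a \<in> m"
    have "open ((\<lambda>x. x - a) -` V)"
      using V(2) by (intro open_vimage continuous_intros)
    moreover have "(\<lambda>x. x - a) -` V \<subseteq> m"
      using Vm a mem_cong by blast
    ultimately show "\<exists>T. open T \<and> a \<in> T \<and> T \<subseteq> m"
      using V(1) by (intro exI[of _ "(\<lambda>x. x - a) -` V"]) auto
  qed
qed

text \<open>The cosets of the open ideal \<open>m\<close> cover the compact ring, so finitely many
  of them suffice.\<close>

lemma finite_residues:
  "\<exists>R. finite R \<and> (\<forall>a. \<exists>r\<in>R. a - r \<in> m)"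
proof -
  let ?C = "\<lambda>r. (\<lambda>x. x - r) -` m"
  have "open (?C r)" for r
    using open_ideal by (intro open_vimage continuous_intros)
  moreover have "UNIV \<subseteq> (\<Union>r\<in>UNIV. ?C r)"
    using zero_mem by (auto intro: exI[of _ "_ :: 'a"])
  ultimately show ?thesis
  proof (rule compactE_image[OF compact])
    fix R assume R: "finite R" "UNIV \<subseteq> (\<Union>r\<in>R. ?C r)"
    have "\<exists>r\<in>R. a - r \<in> m" for a
      using subsetD[OF R(2) UNIV_I, of a] by simp
    with R(1) show ?thesis by blast
  qed
qed

text \<open>Modulo \<open>m\<close> the vector \<open>B c\<close> agrees with \<open>c\<close>, so
  it has an entry outside \<open>m\<close> wherever \<open>c\<close> has one. In this way a
  congruence is turned into an exact left inverse.\<close>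

lemma left_inverse_of_cong_one:
  fixes B :: "nat \<Rightarrow> nat \<Rightarrow> 'a"
  assumes B: "\<And>i j. i < k \<Longrightarrow> j < k \<Longrightarrow> B i j - (if i = j then 1 else 0) \<in> m"
  shows "\<exists>L. \<forall>i<k. \<forall>j<k. (\<Sum>t<k. L i t * B t j) = (if i = j then 1 else 0)"
proof -
  have "\<exists>t\<in>{..<k}. (\<Sum>j<k. B t j * c j) \<notin> m" if c: "\<exists>j<k. c j \<notin> m" for c
  proof -
    obtain t where t: "t < k" "c t \<notin> m"
      using c by blast
    have "(\<Sum>j<k. B t j * c j) - c t = (\<Sum>j<k. B t j * c j) - (\<Sum>j<k. if t = j then c j else 0)"
      using t(1) by simp
    also have "\<dots> = (\<Sum>j<k. c j * (B t j - (if t = j then 1 else 0)))"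
      unfolding sum_subtractf[symmetric] by (intro sum.cong) (auto simp: algebra_simps)
    also have "\<dots> \<in> m"
      using B t(1) by (intro sum_mem mult_mem) auto
    finally show ?thesis
      using t mem_cong by blast
  qed
  from left_inverse_of_unimodular[of m "{..<k}" k B, OF unit zero_mem one_not_mem finite_lessThan this]
  show ?thesis .
qed

end

section \<open>Uniform measure on square arrays\<close>

lemma continuous_map_add_monoid:
  fixes f g :: "'b \<Rightarrow> 'a::topological_monoid_add"
  shows "continuous_map T euclidean f \<Longrightarrow> continuous_map T euclidean g \<Longrightarrow>
    continuous_map T euclidean (\<lambda>x. f x + g x)"
  by (simp add: continuous_map_atin tendsto_add)

lemma continuous_map_mult_semigroup:
  fixes f g :: "'b \<Rightarrow> 'a::topological_semigroup_mult"
  shows "continuous_map T euclidean f \<Longrightarrow> continuous_map T euclidean g \<Longrightarrow>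
    continuous_map T euclidean (\<lambda>x. f x * g x)"
  by (simp add: continuous_map_atin tendsto_mult)

lemma continuous_map_sum_monoid:
  fixes f :: "'i \<Rightarrow> 'b \<Rightarrow> 'a::{comm_monoid_add, topological_monoid_add}"
  shows "(\<And>i. i \<in> A \<Longrightarrow> continuous_map T euclidean (f i)) \<Longrightarrow>
    continuous_map T euclidean (\<lambda>x. \<Sum>i\<in>A. f i x)"
  by (induction A rule: infinite_finite_induct) (auto intro: continuous_map_add_monoid)

lemma continuous_map_restrict_product:
  assumes "\<And>i. i \<in> I \<Longrightarrow> continuous_map T Z (\<lambda>x. g x i)"
  shows "continuous_map T (product_topology (\<lambda>_. Z) I) (\<lambda>x. restrict (g x) I)"
  using assms by (auto simp: continuous_map_componentwise)

section \<open>Borel sets and bases of open sets\<close>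

lemma continuous_map_borel_on_measurable:
  assumes "continuous_map T T' f"
  shows "f \<in> borel_on T \<rightarrow>\<^sub>M borel_on T'"
  unfolding borel_on_def
proof (rule measurable_measure_of)
  show "{U. openin T' U} \<subseteq> Pow (topspace T')"
    using openin_subset by blast
  show "f \<in> space (sigma (topspace T) {U. openin T U}) \<rightarrow> topspace T'"
    using assms by (auto simp: continuous_map_def space_measure_of_conv)
  fix U assume "U \<in> {U. openin T' U}"
  then have "openin T {x \<in> topspace T. f x \<in> U}"
    using openin_continuous_map_preimage[OF assms] by simp
  moreover have "f -` U \<inter> space (sigma (topspace T) {U. openin T U}) = {x \<in> topspace T. f x \<in> U}"
    by (auto simp: space_measure_of_conv)
  moreover have "{U. openin T U} \<subseteq> Pow (topspace T)"
    using openin_subset by blast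
  ultimately show "f -` U \<inter> space (sigma (topspace T) {U. openin T U}) \<in> sets (sigma (topspace T) {U. openin T U})"
    by (auto simp: sets_measure_of)
qed

lemma space_borel_on: "space (borel_on T) = topspace T"
  by (simp add: borel_on_def space_measure_of_conv)

lemma openin_sets_borel_on: "openin T U \<Longrightarrow> U \<in> sets (borel_on T)"
  unfolding borel_on_def by (subst sets_measure_of) (auto dest: openin_subset)

lemma sets_borel_on_euclidean: "sets (borel_on euclidean) = sets (borel :: 'a::topological_space measure)"
  by (simp add: borel_on_def borel_def)

lemma continuous_map_real_borel_on_measurable:
  "continuous_map T euclideanreal f \<Longrightarrow> f \<in> borel_measurable (borel_on T)"
  using continuous_map_borel_on_measurable[of T euclideanreal f]
    measurable_cong_sets[OF refl sets_borel_on_euclidean] by blast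

text \<open>Since \<open>I\<close> is finite, boxes with open sides are open, form a base, and lie
  in the product \<sigma>-algebra.\<close>

lemma measurable_open_base_PiM:
  fixes N :: "'a::topological_space measure" and I :: "'i set"
  assumes I: "finite I" and N: "sets N = sets borel"
  shows "measurable_open_base (product_topology (\<lambda>_. euclidean) I) (\<Pi>\<^sub>M i\<in>I. N)"
  unfolding measurable_open_base_def
proof (intro conjI allI impI)
  have "space N = UNIV"
    using sets_eq_imp_space_eq[OF N] by simp
  then show "space (\<Pi>\<^sub>M i\<in>I. N) = topspace (product_topology (\<lambda>_. euclidean) I)"
    by (simp add: space_PiM)
next
  fix U :: "('i \<Rightarrow> 'a) set" and x
  assume "openin (product_topology (\<lambda>_. euclidean) I) U \<and> x \<in> U"
  then obtain V where V: "\<forall>i\<in>I. openin euclidean (V i)" "x \<in> Pi\<^sub>E I V" "Pi\<^sub>E I V \<subseteq> U"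
    unfolding openin_product_topology_alt by blast
  have "Pi\<^sub>E I V \<in> sets (\<Pi>\<^sub>M i\<in>I. N)"
    using V(1) by (intro sets_PiM_I_finite I) (auto simp: N)
  moreover have "openin (product_topology (\<lambda>_. euclidean) I) (Pi\<^sub>E I V)"
    using V(1) I by (simp add: openin_PiE)
  ultimately show "\<exists>V\<in>sets (\<Pi>\<^sub>M i\<in>I. N). openin (product_topology (\<lambda>_. euclidean) I) V \<and> x \<in> V \<and> V \<subseteq> U"
    using V(2,3) by (intro bexI[of _ "Pi\<^sub>E I V"]) simp_all
qed

section \<open>Arrays indexed by a square\<close>

abbreviation (input) square :: "nat \<Rightarrow> (nat \<times> nat) set" where
  "square n \<equiv> {..<n} \<times> {..<n}"

text \<open>Integrals over the uniform measure are computed on extensional functions, the space of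
  \<open>PiM\<close>; \<open>mat_entries\<close> and \<open>mat n n\<close> translate from and to
  matrices.\<close>

definition entry_space :: "nat \<Rightarrow> (nat \<times> nat \<Rightarrow> 'a::topological_space) topology" where
  "entry_space n = product_topology (\<lambda>_. euclidean) (square n)"

definition entry_add :: "nat \<Rightarrow> (nat \<times> nat \<Rightarrow> 'a::plus) \<Rightarrow> (nat \<times> nat \<Rightarrow> 'a) \<Rightarrow> nat \<times> nat \<Rightarrow> 'a" where
  "entry_add n x y = (\<lambda>ij\<in>square n. x ij + y ij)"

definition entry_mult ::
    "nat \<Rightarrow> (nat \<times> nat \<Rightarrow> 'a::semiring_0) \<Rightarrow> (nat \<times> nat \<Rightarrow> 'a) \<Rightarrow> nat \<times> nat \<Rightarrow> 'a" where
  "entry_mult n x y = restrict (\<lambda>(i, j). \<Sum>k<n. x (i, k) * y (k, j)) (square n)"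

lemma topspace_entry_space: "topspace (entry_space n) = square n \<rightarrow>\<^sub>E UNIV"
  by (simp add: entry_space_def)

lemma entry_add_in [simp]: "entry_add n x y \<in> topspace (entry_space n)"
  and entry_mult_in [simp]: "entry_mult n x y \<in> topspace (entry_space n)"
  by (auto simp: topspace_entry_space entry_add_def entry_mult_def)

lemma continuous_map_entry:
  assumes "continuous_map T (entry_space n) f" "ij \<in> square n"
  shows "continuous_map T euclidean (\<lambda>x. f x ij)"
  using continuous_map_compose[OF assms(1)[unfolded entry_space_def] continuous_map_product_projection[OF assms(2)]]
  by (simp add: o_def)

lemma continuous_map_entry_add:
  fixes f g :: "'b \<Rightarrow> nat \<times> nat \<Rightarrow> 'a::topological_monoid_add"
  assumes "continuous_map T (entry_space n) f" "continuous_map T (entry_space n) g"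
  shows "continuous_map T (entry_space n) (\<lambda>x. entry_add n (f x) (g x))"
  unfolding entry_add_def entry_space_def
  by (intro continuous_map_restrict_product continuous_map_add_monoid continuous_map_entry[OF assms(1)]
      continuous_map_entry[OF assms(2)])

lemma continuous_map_entry_mult:
  fixes f g :: "'b \<Rightarrow> nat \<times> nat \<Rightarrow> 'a::{topological_monoid_add, semiring_0, topological_semigroup_mult}"
  assumes "continuous_map T (entry_space n) f" "continuous_map T (entry_space n) g"
  shows "continuous_map T (entry_space n) (\<lambda>x. entry_mult n (f x) (g x))"
  unfolding entry_mult_def entry_space_def
proof (rule continuous_map_restrict_product)
  fix ij assume "ij \<in> square n"
  then show "continuous_map T euclidean (\<lambda>x. case ij of (i, j) \<Rightarrow> \<Sum>k<n. f x (i, k) * g x (k, j))"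
    by (auto intro!: continuous_map_sum_monoid continuous_map_mult_semigroup
        continuous_map_entry[OF assms(1)] continuous_map_entry[OF assms(2)])
qed

lemma entry_mult_add:
  "entry_mult n (entry_add n x y) b = entry_add n (entry_mult n x b) (entry_mult n y b)"
  by (auto simp: entry_mult_def entry_add_def fun_eq_iff distrib_right sum.distrib)

lemma entry_mult_cancel_left_inverse:
  fixes w l b :: "nat \<times> nat \<Rightarrow> 'a::comm_ring_1"
  assumes l: "\<And>i j. i < n \<Longrightarrow> j < n \<Longrightarrow> (\<Sum>k<n. l (i, k) * b (k, j)) = (if i = j then 1 else 0)"
  shows "entry_mult n (entry_mult n w l) b = restrict w (square n)"
proof (rule ext)
  fix ij :: "nat \<times> nat"
  show "entry_mult n (entry_mult n w l) b ij = restrict w (square n) ij"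
  proof (cases "ij \<in> square n")
    case True
    then obtain i j where ij: "ij = (i, j)" "i < n" "j < n" by auto
    have "(\<Sum>k<n. (\<Sum>s<n. w (i, s) * l (s, k)) * b (k, j)) = (\<Sum>k<n. \<Sum>s<n. w (i, s) * (l (s, k) * b (k, j)))"
      by (simp add: sum_distrib_right mult.assoc)
    also have "\<dots> = (\<Sum>s<n. w (i, s) * (\<Sum>k<n. l (s, k) * b (k, j)))"
      by (subst sum.swap) (simp add: sum_distrib_left)
    also have "\<dots> = (\<Sum>s<n. if s = j then w (i, s) else 0)"
      using ij l by (intro sum.cong) auto
    finally show ?thesis
      using ij by (simp add: entry_mult_def)
  qed (simp add: entry_mult_def)
qed

section \<open>Translations and affine maps of the uniform measure\<close>

context compact_local_ring
begin

lemma compact_entry_space: "compact_space (entry_space n :: (nat \<times> nat \<Rightarrow> 'a) topology)"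
proof -
  have "compact_space (euclidean :: 'a topology)"
    using compact by (simp add: compact_space_def)
  then show ?thesis
    by (simp add: entry_space_def compact_space_product_topology)
qed

lemma borel_measurable_translate: "(\<lambda>x :: 'a. x + w) \<in> borel_measurable borel"
  by (intro borel_measurable_continuous_onI continuous_intros)

text \<open>The product measure is determined by its values on boxes, and the preimage of a box
  under a translation is a box whose sides are translates.\<close>

lemma distr_PiM_translate:
  fixes N :: "'a measure"
  assumes I: "finite I" and N: "sets N = sets borel" "prob_space N"
    and inv: "\<And>g A. A \<in> sets N \<Longrightarrow> emeasure N ((+) g ` A) = emeasure N A"
  shows "distr (\<Pi>\<^sub>M i\<in>I. N) (\<Pi>\<^sub>M i\<in>I. N) (\<lambda>z. \<lambda>i\<in>I. z i + w i) = (\<Pi>\<^sub>M i\<in>I. N)"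
proof -
  interpret prob_space N by fact
  interpret product_sigma_finite "\<lambda>_. N"
    by unfold_locales
  have space: "space N = UNIV"
    using sets_eq_imp_space_eq[OF N(1)] by simp
  have tr: "(\<lambda>x. x + a) \<in> N \<rightarrow>\<^sub>M N" for a
    using borel_measurable_translate measurable_cong_sets[OF N(1) N(1)] by blast
  have meas: "(\<lambda>z. \<lambda>i\<in>I. z i + w i) \<in> (\<Pi>\<^sub>M i\<in>I. N) \<rightarrow>\<^sub>M (\<Pi>\<^sub>M i\<in>I. N)"
    by (intro measurable_restrict measurable_compose[OF _ tr] measurable_component_singleton)
  show ?thesis
  proof (rule PiM_eqI[OF I])
    fix A assume A: "\<And>i. i \<in> I \<Longrightarrow> A i \<in> sets N"
    let ?B = "\<lambda>i. (\<lambda>x. x + w i) -` A i \<inter> space N"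
    \<comment> \<open>Invariance is given for images under left translations, so the preimage is
      rewritten as such an image.\<close>
    have B: "?B i = (+) (- w i) ` A i" for i
    proof -
      have "x \<in> (+) (- w i) ` A i" if "x + w i \<in> A i" for x
        using that by (intro image_eqI[of _ _ "x + w i"]) auto
      then show ?thesis
        by (auto simp: space)
    qed
    have "(\<lambda>z. \<lambda>i\<in>I. z i + w i) -` Pi\<^sub>E I A \<inter> space (\<Pi>\<^sub>M i\<in>I. N) = Pi\<^sub>E I ?B"
      by (auto simp: space_PiM space PiE_iff)
    then have "emeasure (distr (\<Pi>\<^sub>M i\<in>I. N) (\<Pi>\<^sub>M i\<in>I. N) (\<lambda>z. \<lambda>i\<in>I. z i + w i)) (Pi\<^sub>E I A) = emeasure (\<Pi>\<^sub>M i\<in>I. N) (Pi\<^sub>E I ?B)"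
      using I A by (subst emeasure_distr[OF meas]) auto
    also have "\<dots> = (\<Prod>i\<in>I. emeasure N (?B i))"
      using I A measurable_sets[OF tr] by (intro emeasure_PiM) auto
    also have "\<dots> = (\<Prod>i\<in>I. emeasure N (A i))"
      by (intro prod.cong refl) (simp only: B inv[OF A])
    finally show "emeasure (distr (\<Pi>\<^sub>M i\<in>I. N) (\<Pi>\<^sub>M i\<in>I. N) (\<lambda>z. \<lambda>i\<in>I. z i + w i)) (Pi\<^sub>E I A) =
        (\<Prod>i\<in>I. emeasure N (A i))" .
  qed simp
qed

end

locale compact_local_ring_uniform = compact_local_ring m
  for m :: "'a::{comm_ring_1, t2_space, topological_monoid_add, topological_semigroup_mult} set" +
  fixes N :: "'a measure" and n :: nat
  assumes sets_N: "sets N = sets borel" and prob_N: "prob_space N"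
    and translate: "\<And>g A. A \<in> sets N \<Longrightarrow> emeasure N ((+) g ` A) = emeasure N A"
begin

abbreviation "entry_measure \<equiv> \<Pi>\<^sub>M ij\<in>square n. N"

lemma prob_entry_measure: "prob_space entry_measure"
  by (intro prob_space_PiM prob_N)

lemma base_entry_measure: "measurable_open_base (entry_space n) entry_measure"
  unfolding entry_space_def by (intro measurable_open_base_PiM sets_N) simp

lemma space_entry_measure: "space entry_measure = topspace (entry_space n)"
  using base_entry_measure by (simp add: measurable_open_base_def)

lemma integral_entry_translate:
  assumes F: "continuous_map (entry_space n) euclideanreal F"
  shows "(\<integral>z. F (entry_add n z w) \<partial>entry_measure) = (\<integral>z. F z \<partial>entry_measure)"
proof -
  have F_meas: "F \<in> borel_measurable entry_measure"
    by (rule borel_measurable_of_continuous_map[OF base_entry_measure compact_entry_space F])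
  have tr: "(\<lambda>x. x + a) \<in> N \<rightarrow>\<^sub>M N" for a
    using borel_measurable_translate measurable_cong_sets[OF sets_N sets_N] by blast
  have "(\<lambda>z. entry_add n z w) \<in> entry_measure \<rightarrow>\<^sub>M entry_measure"
    unfolding entry_add_def
    by (intro measurable_restrict measurable_compose[OF _ tr] measurable_component_singleton)
  moreover have "distr entry_measure entry_measure (\<lambda>z. entry_add n z w) = entry_measure"
    unfolding entry_add_def by (rule distr_PiM_translate[OF _ sets_N prob_N translate]) auto
  ultimately show ?thesis
    using integral_distr[of "\<lambda>z. entry_add n z w" entry_measure entry_measure F] F_meas by simp
qed

text \<open>No change of variables for \<open>z b\<close> is needed. Let \<open>w\<close> be a
  second uniform array and consider \<open>F (w + z b)\<close>. For fixed \<open>z\<close> the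
  integral over \<open>w\<close> is that of \<open>F\<close>, by translation. For fixed
  \<open>w\<close> the integral over \<open>z\<close> does not depend on \<open>w\<close>, because
  \<open>w - c\<close> can be absorbed into \<open>z\<close>. Exchanging the integrals gives the
  claim.\<close>

lemma integral_entry_affine:
  assumes F: "continuous_map (entry_space n) euclideanreal F" and c: "c \<in> topspace (entry_space n)"
    and l: "\<And>i j. i < n \<Longrightarrow> j < n \<Longrightarrow> (\<Sum>k<n. l (i, k) * b (k, j)) = (if i = j then 1 else 0)"
  shows "(\<integral>z. F (entry_add n c (entry_mult n z b)) \<partial>entry_measure) = (\<integral>z. F z \<partial>entry_measure)"
proof -
  interpret prob_space entry_measure by (rule prob_entry_measure)
  let ?E = "entry_space n :: (nat \<times> nat \<Rightarrow> 'a) topology"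
  let ?h = "\<lambda>w z. F (entry_add n w (entry_mult n z b))"
  have b': "restrict b (square n) \<in> topspace ?E"
    by (simp add: topspace_entry_space)
  \<comment> \<open>\<open>b\<close> is not assumed extensional, whereas the continuity lemmas need
    a point of \<open>entry_space n\<close>.\<close>
  have mult_b: "entry_mult n z b = entry_mult n z (restrict b (square n))" for z
    by (auto simp: entry_mult_def fun_eq_iff intro!: sum.cong)
  have h: "continuous_map (prod_topology ?E ?E) euclideanreal (\<lambda>(w, z). ?h w z)"
  proof -
    have "continuous_map (prod_topology ?E ?E) ?E (\<lambda>p. entry_add n (fst p) (entry_mult n (snd p) (restrict b (square n))))"
      using b' by (intro continuous_map_entry_add continuous_map_entry_mult continuous_map_fst continuous_map_snd) simp
    from continuous_map_compose[OF this F] show ?thesis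
      by (simp add: o_def mult_b case_prod_unfold)
  qed
  have "(\<integral>z. ?h c z \<partial>entry_measure) = (\<integral>z. (1::real) \<partial>entry_measure) * (\<integral>z. F z \<partial>entry_measure)"
  proof (rule integral_exchange[OF base_entry_measure compact_entry_space compact_entry_space prob_entry_measure h,
        where \<tau> = "\<lambda>z. z"])
    fix w assume w: "w \<in> topspace ?E"
    have hw: "continuous_map ?E euclideanreal (?h w)"
      by (rule continuous_map_slice(2)[OF h w])
    show "integrable entry_measure (\<lambda>z. 1 * ?h w z)"
      using integrable_of_continuous_map[OF base_entry_measure compact_entry_space finite_measure_axioms hw] by simp
    \<comment> \<open>Chosen so that \<open>v b = w - c\<close> on the square: translating
      \<open>z\<close> by \<open>v\<close> turns \<open>c + z b\<close> into
      \<open>w + z b\<close>.\<close>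
    define v where "v = entry_mult n (\<lambda>ij. w ij - c ij) l"
    have "entry_mult n v b = restrict (\<lambda>ij. w ij - c ij) (square n)"
      unfolding v_def by (rule entry_mult_cancel_left_inverse[OF l])
    then have "entry_add n c (entry_mult n (entry_add n z v) b) = entry_add n w (entry_mult n z b)" for z
      unfolding entry_mult_add by (auto simp: entry_add_def fun_eq_iff)
    then show "(\<integral>z. 1 * ?h w z \<partial>entry_measure) = (\<integral>z. ?h c z \<partial>entry_measure)"
      using integral_entry_translate[OF continuous_map_slice(2)[OF h c], of v] by simp
  next
    fix z assume "z \<in> space entry_measure"
    show "(\<integral>w. ?h w z \<partial>entry_measure) = (\<integral>z. F z \<partial>entry_measure)"
      by (rule integral_entry_translate[OF F])
  qed (simp_all add: space_entry_measure)
  then show ?thesis by (simp add: prob_space)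
qed

end

section \<open>The general linear group\<close>

lemma topspace_mat_topology: "topspace (mat_topology n) = carrier_mat n n"
  by (auto simp: mat_topology_def topspace_pullback_topology mat_entries_def)

lemma topspace_GL_topology: "topspace (GL_topology n) = carrier (GL n)"
  by (auto simp: GL_topology_def topspace_mat_topology GL_def)

lemma carrier_GL: "g \<in> carrier (GL n) \<longleftrightarrow> g \<in> carrier_mat n n \<and> det g dvd 1"
  by (simp add: GL_def)

lemma mult_GL: "g \<otimes>\<^bsub>GL n\<^esub> h = g * h"
  by (simp add: GL_def)

lemma GL_mult_closed: "g \<in> carrier (GL n) \<Longrightarrow> h \<in> carrier (GL n) \<Longrightarrow> g * h \<in> carrier (GL n)"
  by (auto simp: carrier_GL det_mult intro: mult_dvd_mono[of _ 1 _ 1, simplified])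

text \<open>The adjugate divided by the unit determinant is a two-sided inverse over any commutative
  ring.\<close>

lemma GL_left_inverse:
  fixes g :: "'a::comm_ring_1 mat"
  assumes "g \<in> carrier (GL n)"
  obtains h where "h \<in> carrier (GL n)" "h * g = 1\<^sub>m n" "g * h = 1\<^sub>m n"
proof -
  from assms have g: "g \<in> carrier_mat n n" and "det g dvd 1"
    by (simp_all add: carrier_GL)
  then obtain u where u: "det g * u = 1"
    by (metis dvdE)
  define h where "h = u \<cdot>\<^sub>m adj_mat g"
  note adj = adj_mat[OF g]
  have h: "h \<in> carrier_mat n n"
    using adj(1) by (simp add: h_def)
  have scalar: "u \<cdot>\<^sub>m (det g \<cdot>\<^sub>m 1\<^sub>m n) = 1\<^sub>m n"
    by (rule eq_matI) (use u in \<open>auto simp: mult.commute\<close>)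
  have hg: "h * g = 1\<^sub>m n"
    by (simp add: h_def mult_smult_assoc_mat[OF adj(1) g] adj(3) scalar)
  have gh: "g * h = 1\<^sub>m n"
    by (simp add: h_def mult_smult_distrib[OF g adj(1)] adj(2) scalar)
  have "det g * det h = 1"
    using det_mult[OF g h] gh by simp
  then have "h \<in> carrier (GL n)"
    using h unfolding carrier_GL by (metis dvd_triv_right)
  with hg gh show thesis by (intro that)
qed

section \<open>Continuity on matrices and invariance of Haar measure\<close>

lemma continuous_map_mat_entries: "continuous_map (mat_topology n) (entry_space n) (mat_entries n)"
  using continuous_map_pullback[OF continuous_map_id[of "entry_space n"],
      where A = "carrier_mat n n" and f = "mat_entries n"]
  by (simp add: mat_topology_def entry_space_def)

lemma continuous_map_mat_index:
  assumes "continuous_map T (mat_topology n) f" "i < n" "j < n"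
  shows "continuous_map T euclidean (\<lambda>x. f x $$ (i, j))"
  using continuous_map_entry[OF continuous_map_compose[OF assms(1) continuous_map_mat_entries],
      where ij = "(i, j)"] assms(2,3)
  by (simp add: o_def mat_entries_def)

lemma continuous_map_into_mat_topology:
  assumes "\<And>x. x \<in> topspace T \<Longrightarrow> f x \<in> carrier_mat n n"
    and "\<And>i j. i < n \<Longrightarrow> j < n \<Longrightarrow> continuous_map T euclidean (\<lambda>x. f x $$ (i, j))"
  shows "continuous_map T (mat_topology n) f"
  unfolding mat_topology_def
proof (rule continuous_map_pullback')
  show "continuous_map T (product_topology (\<lambda>_. euclidean) (square n)) (mat_entries n \<circ> f)"
    unfolding mat_entries_def o_def using assms(2)
    by (intro continuous_map_restrict_product) auto
  show "topspace T \<subseteq> f -` carrier_mat n n"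
    using assms(1) by auto
qed

lemma continuous_map_GL_index:
  "i < n \<Longrightarrow> j < n \<Longrightarrow> continuous_map (GL_topology n) euclidean (\<lambda>Y. Y $$ (i, j))"
  unfolding GL_topology_def
  by (rule continuous_map_from_subtopology[OF continuous_map_mat_index[OF continuous_map_id, unfolded id_apply]])

lemma times_mat_index:
  "g \<in> carrier_mat d d \<Longrightarrow> Y \<in> carrier_mat d d \<Longrightarrow> i < d \<Longrightarrow> j < d \<Longrightarrow>
    (g * Y) $$ (i, j) = (\<Sum>t<d. g $$ (i, t) * Y $$ (t, j))"
  by (auto simp: scalar_prod_def lessThan_atLeast0 intro!: sum.cong)

lemma continuous_map_GL_mult_left:
  fixes g :: "'a::{comm_ring_1, topological_monoid_add, topological_semigroup_mult} mat"
  assumes g: "g \<in> carrier (GL n)"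
  shows "continuous_map (GL_topology n) (GL_topology n) (\<lambda>Y. g * Y)"
proof -
  have gc: "g \<in> carrier_mat n n"
    using g by (simp add: carrier_GL)
  have "continuous_map (GL_topology n) (mat_topology n) (\<lambda>Y. g * Y)"
  proof (rule continuous_map_into_mat_topology)
    fix Y :: "'a mat" assume "Y \<in> topspace (GL_topology n)"
    then show "g * Y \<in> carrier_mat n n"
      using gc by (auto simp: topspace_GL_topology carrier_GL)
  next
    fix i j assume ij: "i < n" "j < n"
    have "continuous_map (GL_topology n) euclidean (\<lambda>Y. \<Sum>t<n. g $$ (i, t) * Y $$ (t, j))"
      using ij by (intro continuous_map_sum_monoid continuous_map_mult_semigroup continuous_map_GL_index) auto
    then show "continuous_map (GL_topology n) euclidean (\<lambda>Y. (g * Y) $$ (i, j))"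
      by (rule continuous_map_eq) (use ij gc in \<open>simp add: times_mat_index topspace_GL_topology carrier_GL\<close>)
  qed
  then show ?thesis
    unfolding GL_topology_def using g
    by (subst continuous_map_in_subtopology)
      (auto simp: topspace_GL_topology[unfolded GL_topology_def] intro: GL_mult_closed)
qed

text \<open>The definition states invariance for images \<open>g A\<close>. Since \<open>g\<close>
  is invertible, every measurable \<open>A\<close> is the image of its own preimage, so the
  push-forward is invariant as well.\<close>

lemma normalized_haar_distr_mult:
  fixes g :: "'a::{comm_ring_1, topological_monoid_add, topological_semigroup_mult} mat"
  assumes Q: "normalized_haar_measure (GL n) (GL_topology n) Q" and g: "g \<in> carrier (GL n)"
  shows "(\<lambda>Y. g * Y) \<in> Q \<rightarrow>\<^sub>M Q" and "distr Q Q (\<lambda>Y. g * Y) = Q"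
proof -
  have sets: "sets Q = sets (borel_on (GL_topology n))"
    and inv: "\<And>A. A \<in> sets Q \<Longrightarrow> emeasure Q ((\<lambda>Y. g * Y) ` A) = emeasure Q A"
    using Q g by (auto simp: normalized_haar_measure_def regular_borel_prob_def mult_GL)
  have space: "space Q = carrier (GL n)"
    using sets_eq_imp_space_eq[OF sets] by (simp add: space_borel_on topspace_GL_topology)
  show meas: "(\<lambda>Y. g * Y) \<in> Q \<rightarrow>\<^sub>M Q"
    using continuous_map_borel_on_measurable[OF continuous_map_GL_mult_left[OF g]]
      measurable_cong_sets[OF sets sets] by blast
  obtain h where h: "h \<in> carrier (GL n)" "h * g = 1\<^sub>m n" "g * h = 1\<^sub>m n"
    by (rule GL_left_inverse[OF g])
  show "distr Q Q (\<lambda>Y. g * Y) = Q"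
  proof (rule measure_eqI)
    fix A assume "A \<in> sets (distr Q Q (\<lambda>Y. g * Y))"
    then have A: "A \<in> sets Q" by simp
    let ?B = "(\<lambda>Y. g * Y) -` A \<inter> space Q"
    have "(\<lambda>Y. g * Y) ` ?B = A"
    proof (intro equalityI subsetI)
      fix Y assume Y: "Y \<in> A"
      then have YG: "Y \<in> carrier (GL n)"
        using sets.sets_into_space[OF A] space by blast
      then have "g * (h * Y) = Y"
        using g h by (subst assoc_mult_mat[symmetric, of _ n n _ n _ n]) (auto simp: carrier_GL)
      moreover have "h * Y \<in> space Q"
        using GL_mult_closed[OF h(1) YG] by (simp add: space)
      ultimately show "Y \<in> (\<lambda>Y. g * Y) ` ?B"
        using Y by (intro image_eqI[of _ _ "h * Y"]) auto
    qed auto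
    with inv[OF measurable_sets[OF meas A]] show "emeasure (distr Q Q (\<lambda>Y. g * Y)) A = emeasure Q A"
      by (simp add: emeasure_distr[OF meas A])
  qed simp
qed

section \<open>Row operations\<close>

text \<open>The unipotent block matrix \<open>[[1, x], [0, 1]]\<close> with blocks of size
  \<open>n\<close> and \<open>d - n\<close>. The second argument of \<open>x\<close> is the actual
  row index in \<open>{n..<d}\<close>, not an offset.\<close>

definition shear_mat :: "nat \<Rightarrow> nat \<Rightarrow> (nat \<Rightarrow> nat \<Rightarrow> 'a::comm_ring_1) \<Rightarrow> 'a mat" where
  "shear_mat d n x = mat d d (\<lambda>(i, t). if i = t then 1 else if i < n \<and> n \<le> t then x i t else 0)"

lemma shear_mat_GL: "shear_mat d n x \<in> carrier (GL d)"
proof -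
  have c: "shear_mat d n x \<in> carrier_mat d d"
    by (simp add: shear_mat_def)
  have "upper_triangular (shear_mat d n x)"
    by (auto simp: upper_triangular_def shear_mat_def)
  then have "det (shear_mat d n x) = prod_list (diag_mat (shear_mat d n x))"
    using c by (rule det_upper_triangular)
  also have "\<dots> = 1"
    by (simp add: prod_list_diag_prod shear_mat_def)
  finally show ?thesis
    using c by (simp add: carrier_GL)
qed

lemma shear_mat_mult_index:
  assumes "Y \<in> carrier_mat d d" "i < d" "j < d" "n \<le> d"
  shows "(shear_mat d n x * Y) $$ (i, j) =
    Y $$ (i, j) + (if i < n then \<Sum>t\<in>{n..<d}. x i t * Y $$ (t, j) else 0)"
proof -
  have "(shear_mat d n x * Y) $$ (i, j) = (\<Sum>t<d. shear_mat d n x $$ (i, t) * Y $$ (t, j))"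
    using assms by (intro times_mat_index) (auto simp: shear_mat_def)
  also have "\<dots> = (\<Sum>t<d. (if t = i then Y $$ (i, j) else 0) + (if i < n \<and> n \<le> t then x i t * Y $$ (t, j) else 0))"
    using assms by (intro sum.cong) (auto simp: shear_mat_def)
  also have "\<dots> = Y $$ (i, j) + (\<Sum>t<d. if i < n \<and> n \<le> t then x i t * Y $$ (t, j) else 0)"
    using assms by (simp add: sum.distrib)
  also have "(\<Sum>t<d. if i < n \<and> n \<le> t then x i t * Y $$ (t, j) else 0) =
      (if i < n then \<Sum>t\<in>{n..<d}. x i t * Y $$ (t, j) else 0)"
  proof -
    have "{n..<d} = {..<d} \<inter> {t. n \<le> t}" by auto
    then show ?thesis by (simp add: sum.inter_restrict)
  qed
  finally show ?thesis .
qed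

lemma addrow_mat_GL: "s \<noteq> i \<Longrightarrow> addrow_mat d 1 s i \<in> carrier (GL d)"
  by (simp add: carrier_GL det_addrow_mat)

lemma addrow_mat_mult_index:
  assumes "Y \<in> carrier_mat d d" "s < d" "i < d" "t < d" "j < d"
  shows "(addrow_mat d 1 s i * Y) $$ (t, j) = (if t = s then Y $$ (i, j) + Y $$ (s, j) else Y $$ (t, j))"
  using assms by (subst addrow_mat[symmetric, of Y d d i 1 s]) (auto simp: mat_addrow_def)

section \<open>The corner of a Haar-distributed matrix\<close>

locale compact_local_ring_GL = compact_local_ring_uniform m N n
  for m :: "'a::{comm_ring_1, t2_space, topological_monoid_add, topological_semigroup_mult} set"
    and N :: "'a measure" and n :: nat +
  fixes d :: nat and Q :: "'a mat measure"
  assumes n_le_d: "n \<le> d" and haar: "normalized_haar_measure (GL d) (GL_topology d) Q"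
begin

lemma sets_Q: "sets Q = sets (borel_on (GL_topology d))"
  using haar by (simp add: normalized_haar_measure_def regular_borel_prob_def)

lemma prob_Q: "prob_space Q"
  using haar by (simp add: normalized_haar_measure_def regular_borel_prob_def)

lemma space_Q: "space Q = carrier (GL d)"
  using sets_eq_imp_space_eq[OF sets_Q] by (simp add: space_borel_on topspace_GL_topology)

lemma borel_measurable_Q: "continuous_map (GL_topology d) euclideanreal f \<Longrightarrow> f \<in> borel_measurable Q"
  using continuous_map_real_borel_on_measurable measurable_cong_sets[OF sets_Q refl] by blast

lemma integral_GL_mult:
  fixes f :: "'a mat \<Rightarrow> real"
  assumes "g \<in> carrier (GL d)" "f \<in> borel_measurable Q"
  shows "(\<integral>Y. f (g * Y) \<partial>Q) = (\<integral>Y. f Y \<partial>Q)"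
  using integral_distr[OF normalized_haar_distr_mult(1)[OF haar assms(1)] assms(2)]
  by (simp add: normalized_haar_distr_mult(2)[OF haar assms(1)])

lemma measure_GL_mult:
  assumes "g \<in> carrier (GL d)" "A \<in> sets Q"
  shows "measure Q {Y \<in> carrier (GL d). g * Y \<in> A} = measure Q A"
proof -
  have "measure Q A = measure (distr Q Q (\<lambda>Y. g * Y)) A"
    by (simp add: normalized_haar_distr_mult(2)[OF haar assms(1)])
  also have "\<dots> = measure Q ((\<lambda>Y. g * Y) -` A \<inter> space Q)"
    by (rule measure_distr[OF normalized_haar_distr_mult(1)[OF haar assms(1)] assms(2)])
  also have "(\<lambda>Y. g * Y) -` A \<inter> space Q = {Y \<in> carrier (GL d). g * Y \<in> A}"
    by (auto simp: space_Q)
  finally show ?thesis by simp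
qed

lemma sets_Q_mem:
  assumes "continuous_map (GL_topology d) euclidean f"
  shows "{Y \<in> carrier (GL d). f Y \<in> m} \<in> sets Q"
proof -
  have "openin (GL_topology d) {Y \<in> topspace (GL_topology d). f Y \<in> m}"
    using open_ideal by (intro openin_continuous_map_preimage[OF assms]) simp
  then show ?thesis
    unfolding sets_Q topspace_GL_topology by (rule openin_sets_borel_on)
qed

lemma carrier_GL_sets: "carrier (GL d) \<in> sets Q"
  using sets.top[of Q] by (simp add: space_Q)

section \<open>Events on which the corner is exactly uniform\<close>

lemma continuous_map_lower_comb:
  fixes l :: "nat \<Rightarrow> 'a"
  shows "j < n \<Longrightarrow> continuous_map (GL_topology d) euclidean (\<lambda>Y. \<Sum>t\<in>{n..<d}. l t * Y $$ (t, j))"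
  using n_le_d by (intro continuous_map_sum_monoid continuous_map_mult_semigroup continuous_map_GL_index) auto

text \<open>The array \<open>l\<close> is fixed and does not vary with \<open>Y\<close>, so that the
  shear built from it is one group element. A congruence modulo \<open>m\<close> is required in
  place of an equality so that finitely many \<open>l\<close> suffice.\<close>

definition pivot_event :: "(nat \<times> nat \<Rightarrow> 'a) \<Rightarrow> 'a mat set" where
  "pivot_event l = {Y \<in> carrier (GL d). \<forall>i<n. \<forall>j<n.
     (\<Sum>t\<in>{n..<d}. l (i, t) * Y $$ (t, j)) - (if i = j then 1 else 0) \<in> m}"

lemma pivot_event_sets: "pivot_event l \<in> sets Q"
proof -
  \<comment> \<open>The identity matrix is subtracted by adding the constants -1 and 0, so that
    continuity of addition applies.\<close>
  have "{Y \<in> carrier (GL d). (\<Sum>t\<in>{n..<d}. l (i, t) * Y $$ (t, j)) + (if i = j then - 1 else 0) \<in> m} \<in> sets Q"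
    if "j < n" for i j
    using that by (intro sets_Q_mem continuous_map_add_monoid continuous_map_lower_comb) auto
  \<comment> \<open>Intersecting with the carrier covers \<open>n = 0\<close>, where the
    intersection over the empty square is everything.\<close>
  then have "(\<Inter>(i, j)\<in>square n. {Y \<in> carrier (GL d).
      (\<Sum>t\<in>{n..<d}. l (i, t) * Y $$ (t, j)) + (if i = j then - 1 else 0) \<in> m}) \<inter> carrier (GL d) \<in> sets Q"
    using carrier_GL_sets by (cases "n = 0") (auto intro!: sets.Int sets.finite_INT)
  moreover have "(\<Inter>(i, j)\<in>square n. {Y \<in> carrier (GL d).
      (\<Sum>t\<in>{n..<d}. l (i, t) * Y $$ (t, j)) + (if i = j then - 1 else 0) \<in> m}) \<inter> carrier (GL d) = pivot_event l"
    by (auto simp: pivot_event_def)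
  ultimately show ?thesis by simp
qed

definition shear_invariant :: "'a mat set \<Rightarrow> bool" where
  "shear_invariant G \<longleftrightarrow> (\<forall>x. \<forall>Y\<in>carrier (GL d). shear_mat d n x * Y \<in> G \<longleftrightarrow> Y \<in> G)"

lemma shear_mat_lower_index:
  assumes "Y \<in> carrier (GL d)" "n \<le> t" "t < d" "j < d"
  shows "(shear_mat d n x * Y) $$ (t, j) = Y $$ (t, j)"
  using assms n_le_d by (simp add: shear_mat_mult_index carrier_GL)

text \<open>The event depends only on the rows from \<open>n\<close> on, which a shear leaves
  unchanged.\<close>

lemma shear_invariant_pivot_event: "shear_invariant (pivot_event l)"
  using n_le_d by (auto simp: shear_invariant_def pivot_event_def shear_mat_lower_index shear_mat_GL
      intro: GL_mult_closed)

lemma shear_invariant_UN: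
  "(\<And>i. i \<in> A \<Longrightarrow> shear_invariant (G i)) \<Longrightarrow> shear_invariant (\<Union>i\<in>A. G i)"
  unfolding shear_invariant_def by blast

lemma shear_invariant_Diff:
  "shear_invariant G \<Longrightarrow> shear_invariant H \<Longrightarrow> shear_invariant (G - H)"
  unfolding shear_invariant_def by blast

lemma mat_entries_in: "mat_entries n Y \<in> topspace (entry_space n)"
  by (auto simp: topspace_entry_space mat_entries_def)

lemma continuous_map_GL_mat_entries: "continuous_map (GL_topology d) (entry_space n) (mat_entries n)"
  unfolding mat_entries_def entry_space_def using n_le_d
  by (intro continuous_map_restrict_product) (auto intro: continuous_map_GL_index)

text \<open>Let \<beta> be \<open>l\<close> times the lower rows of the first \<open>n\<close>
  columns. The shear by \<open>x l\<close> turns the corner \<open>c\<close> into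
  \<open>c + x\<close> \<beta> and preserves both \<open>Q\<close> and \<open>G\<close>, so the
  integral over \<open>Y\<close> is the same for all \<open>x\<close>. For fixed \<open>Y\<close> in
  \<open>G\<close>, averaging over uniform \<open>x\<close> gives the integral of \<open>F\<close>,
  since \<beta> is invertible. Subsets \<open>G\<close> of the event are allowed so that overlaps
  between pivot events can be removed.\<close>

lemma integral_pivot:
  assumes F: "continuous_map (entry_space n) euclideanreal F"
    and G: "G \<in> sets Q" "G \<subseteq> pivot_event l" "shear_invariant G"
  shows "(\<integral>Y. indicator G Y * F (mat_entries n Y) \<partial>Q) = measure Q G * (\<integral>z. F z \<partial>entry_measure)"
proof -
  interpret prob_space Q by (rule prob_Q)
  let ?E = "entry_space n :: (nat \<times> nat \<Rightarrow> 'a) topology"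
  define \<beta> where "\<beta> Y = restrict (\<lambda>(i, j). \<Sum>t\<in>{n..<d}. l (i, t) * Y $$ (t, j)) (square n)" for Y :: "'a mat"
  let ?h = "\<lambda>x (c, b). F (entry_add n c (entry_mult n x b))"
  let ?\<tau> = "\<lambda>Y. (mat_entries n Y, \<beta> Y)"
  have h: "continuous_map (prod_topology ?E (prod_topology ?E ?E)) euclideanreal (\<lambda>(x, p). ?h x p)"
  proof -
    have "continuous_map (prod_topology ?E (prod_topology ?E ?E)) ?E
        (\<lambda>p. entry_add n (fst (snd p)) (entry_mult n (fst p) (snd (snd p))))"
      by (intro continuous_map_entry_add continuous_map_entry_mult continuous_map_fst
          continuous_map_compose[OF continuous_map_snd continuous_map_fst, unfolded o_def]
          continuous_map_compose[OF continuous_map_snd continuous_map_snd, unfolded o_def])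
    from continuous_map_compose[OF this F] show ?thesis
      by (simp add: o_def case_prod_unfold)
  qed
  have \<tau>: "continuous_map (GL_topology d) (prod_topology ?E ?E) ?\<tau>"
    unfolding continuous_map_pairwise o_def fst_conv snd_conv
  proof
    show "continuous_map (GL_topology d) ?E (mat_entries n)"
      by (rule continuous_map_GL_mat_entries)
    show "continuous_map (GL_topology d) ?E \<beta>"
      unfolding \<beta>_def entry_space_def
      by (intro continuous_map_restrict_product) (auto intro: continuous_map_lower_comb)
  qed
  have int: "integrable Q (\<lambda>Y. indicator G Y * ?h x (?\<tau> Y))" if x: "x \<in> topspace ?E" for x
  proof -
    have hx: "continuous_map (prod_topology ?E ?E) euclideanreal (?h x)"
      using continuous_map_slice(2)[OF h x] .
    have "compact_space (prod_topology ?E ?E)"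
      by (simp add: compact_space_prod_topology compact_entry_space)
    from bounded_of_continuous_map[OF this hx]
    obtain B where B: "\<And>p. p \<in> topspace (prod_topology ?E ?E) \<Longrightarrow> norm (?h x p) \<le> B"
      unfolding bounded_iff by blast
    have "norm (?h x (?\<tau> Y)) \<le> B" for Y
      using mat_entries_in by (intro B) (simp add: \<beta>_def topspace_entry_space)
    moreover have "(\<lambda>Y. ?h x (?\<tau> Y)) \<in> borel_measurable Q"
      using borel_measurable_Q[OF continuous_map_compose[OF \<tau> hx]] by (simp add: o_def)
    ultimately have "integrable Q (\<lambda>Y. ?h x (?\<tau> Y))"
      by (intro integrable_const_bound[of _ B]) auto
    from integrable_real_mult_indicator[OF G(1) this] show ?thesis
      by (simp only: mult.commute[of "indicator G _"])
  qed
  \<comment> \<open>At \<open>x = 0\<close> the integrand is the unshifted one, whose measurability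
    is thus a case of \<open>int\<close>.\<close>
  have zero: "(\<lambda>ij\<in>square n. 0) \<in> topspace ?E"
    by (simp add: topspace_entry_space)
  have h0: "?h (\<lambda>ij\<in>square n. 0) (?\<tau> Y) = F (mat_entries n Y)" for Y
  proof -
    have "entry_add n (mat_entries n Y) (entry_mult n (\<lambda>ij\<in>square n. 0) (\<beta> Y)) = mat_entries n Y"
      by (auto simp: entry_add_def entry_mult_def mat_entries_def fun_eq_iff)
    then show ?thesis by simp
  qed
  have meas: "(\<lambda>Y. indicator G Y * F (mat_entries n Y)) \<in> borel_measurable Q"
    using borel_measurable_integrable[OF int[OF zero]] by (simp only: h0)
  have "(\<integral>Y. indicator G Y * F (mat_entries n Y) \<partial>Q) = (\<integral>Y. indicator G Y \<partial>Q) * (\<integral>z. F z \<partial>entry_measure)"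
  proof (rule integral_exchange[OF base_entry_measure compact_entry_space _ prob_entry_measure h, where \<tau> = ?\<tau>])
    show "compact_space (prod_topology ?E ?E)"
      by (simp add: compact_space_prod_topology compact_entry_space)
    show "?\<tau> Y \<in> topspace (prod_topology ?E ?E)" for Y
      using mat_entries_in by (simp add: \<beta>_def topspace_entry_space)
    show "integrable Q (indicator G :: _ \<Rightarrow> real)"
      using G(1) by (simp add: less_top[symmetric])
    fix x assume x: "x \<in> topspace ?E"
    show "integrable Q (\<lambda>Y. indicator G Y * ?h x (?\<tau> Y))"
      by (rule int[OF x])
    \<comment> \<open>The upper right block of the shear is the matrix product
      \<open>x l\<close>.\<close>
    let ?g = "shear_mat d n (\<lambda>i t. \<Sum>k<n. x (i, k) * l (k, t))"
    have shifted: "mat_entries n (?g * Y) = entry_add n (mat_entries n Y) (entry_mult n x (\<beta> Y))"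
      if Y: "Y \<in> carrier (GL d)" for Y
    proof
      fix ij
      show "mat_entries n (?g * Y) ij = entry_add n (mat_entries n Y) (entry_mult n x (\<beta> Y)) ij"
      proof (cases "ij \<in> square n")
        case True
        then obtain i j where ij: "ij = (i, j)" "i < n" "j < n" by auto
        have "(\<Sum>t\<in>{n..<d}. (\<Sum>k<n. x (i, k) * l (k, t)) * Y $$ (t, j)) =
            (\<Sum>t\<in>{n..<d}. \<Sum>k<n. x (i, k) * (l (k, t) * Y $$ (t, j)))"
          by (simp add: sum_distrib_right mult.assoc)
        also have "\<dots> = (\<Sum>k<n. x (i, k) * (\<Sum>t\<in>{n..<d}. l (k, t) * Y $$ (t, j)))"
          by (subst sum.swap) (simp add: sum_distrib_left)
        finally show ?thesis
          using ij Y n_le_d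
          by (simp add: mat_entries_def entry_add_def entry_mult_def \<beta>_def shear_mat_mult_index carrier_GL)
      qed (simp add: mat_entries_def entry_add_def)
    qed
    have "(\<integral>Y. indicator G Y * ?h x (?\<tau> Y) \<partial>Q) = (\<integral>Y. indicator G (?g * Y) * F (mat_entries n (?g * Y)) \<partial>Q)"
      using G(3) by (intro Bochner_Integration.integral_cong refl)
        (simp add: space_Q shifted shear_invariant_def indicator_def)
    then show "(\<integral>Y. indicator G Y * ?h x (?\<tau> Y) \<partial>Q) = (\<integral>Y. indicator G Y * F (mat_entries n Y) \<partial>Q)"
      using integral_GL_mult[OF shear_mat_GL meas] by simp
  next
    fix Y assume "(indicator G Y :: real) \<noteq> 0"
    then have "Y \<in> pivot_event l"
      using G(2) by (auto simp: indicator_def split: if_splits)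
    \<comment> \<open>On \<open>G\<close> the array \<beta> is congruent to the identity, hence has
      an exact left inverse, as the affine substitution requires.\<close>
    then have "\<And>i j. i < n \<Longrightarrow> j < n \<Longrightarrow> \<beta> Y (i, j) - (if i = j then 1 else 0) \<in> m"
      by (simp add: pivot_event_def \<beta>_def)
    from left_inverse_of_cong_one[of n "\<lambda>i j. \<beta> Y (i, j)", OF this]
    obtain L where L: "\<forall>i<n. \<forall>j<n. (\<Sum>t<n. L i t * \<beta> Y (t, j)) = (if i = j then 1 else 0)"
      by blast
    show "(\<integral>x. ?h x (?\<tau> Y) \<partial>entry_measure) = (\<integral>z. F z \<partial>entry_measure)"
      using integral_entry_affine[OF F mat_entries_in, of "\<lambda>(i, j). L i j" "\<beta> Y" Y] L by simp
  qed
  then show ?thesis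
    using G(1) sets.sets_into_space[OF G(1)] by (simp add: Int_absorb2)
qed

section \<open>Probability of the exceptional events\<close>

abbreviation column_comb :: "(nat \<Rightarrow> 'a) \<Rightarrow> 'a mat \<Rightarrow> nat \<Rightarrow> 'a" where
  "column_comb c Y t \<equiv> \<Sum>j<n. Y $$ (t, j) * c j"

text \<open>Modulo \<open>m\<close>, the vector \<open>c\<close> lies in the kernel of the lower
  part of the first \<open>n\<close> columns.\<close>

definition degenerate_event :: "(nat \<Rightarrow> 'a) \<Rightarrow> 'a mat set" where
  "degenerate_event c = {Y \<in> carrier (GL d). \<forall>t\<in>{n..<d}. column_comb c Y t \<in> m}"

lemma column_comb_sets:
  "t < d \<Longrightarrow> {Y \<in> carrier (GL d). column_comb c Y t \<in> m} \<in> sets Q"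
  using n_le_d
  by (intro sets_Q_mem continuous_map_sum_monoid continuous_map_mult_semigroup continuous_map_GL_index) auto

lemma column_comb_Ball_sets:
  assumes "A \<subseteq> {..<d}"
  shows "{Y \<in> carrier (GL d). \<forall>t\<in>A. column_comb c Y t \<in> m} \<in> sets Q"
proof -
  have "finite A"
    using assms finite_subset by blast
  then have "carrier (GL d) \<inter> (\<Inter>t\<in>A. {Y \<in> carrier (GL d). column_comb c Y t \<in> m}) \<in> sets Q"
    using assms carrier_GL_sets column_comb_sets by (cases "A = {}") (auto intro!: sets.Int sets.finite_INT)
  moreover have "carrier (GL d) \<inter> (\<Inter>t\<in>A. {Y \<in> carrier (GL d). column_comb c Y t \<in> m}) =
      {Y \<in> carrier (GL d). \<forall>t\<in>A. column_comb c Y t \<in> m}"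
    by auto
  ultimately show ?thesis by simp
qed

lemma degenerate_event_sets: "degenerate_event c \<in> sets Q"
  unfolding degenerate_event_def by (intro column_comb_Ball_sets) auto

text \<open>Pad \<open>c\<close> with zeros to length \<open>d\<close>. Row \<open>j\<close> of the
  inverse of \<open>Y\<close> recovers \<open>c j\<close> from the product of \<open>Y\<close> with
  this vector, so \<open>c j\<close> would lie in the ideal if all entries of the product
  did.\<close>

lemma ex_unit_column_comb:
  assumes Y: "Y \<in> carrier (GL d)" and c: "j < n" "c j \<notin> m"
  shows "\<exists>t<d. column_comb c Y t \<notin> m"
proof (rule ccontr)
  assume "\<not> (\<exists>t<d. column_comb c Y t \<notin> m)"
  then have mem: "\<And>t. t < d \<Longrightarrow> column_comb c Y t \<in> m" by blast
  obtain h where h: "h \<in> carrier (GL d)" "h * Y = 1\<^sub>m d"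
    using GL_left_inverse[OF Y] by metis
  have "(\<Sum>t<d. h $$ (j, t) * column_comb c Y t) = (\<Sum>t<d. \<Sum>k<n. (h $$ (j, t) * Y $$ (t, k)) * c k)"
    by (simp add: sum_distrib_left mult.assoc)
  also have "\<dots> = (\<Sum>k<n. (\<Sum>t<d. h $$ (j, t) * Y $$ (t, k)) * c k)"
    by (subst sum.swap) (simp add: sum_distrib_right)
  also have "\<dots> = (\<Sum>k<n. if k = j then c k else 0)"
  proof (rule sum.cong)
    fix k assume "k \<in> {..<n}"
    then have "(\<Sum>t<d. h $$ (j, t) * Y $$ (t, k)) = (1\<^sub>m d :: 'a mat) $$ (j, k)"
      unfolding h(2)[symmetric] using h(1) Y c(1) n_le_d
      by (subst times_mat_index) (auto simp: carrier_GL)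
    then show "(\<Sum>t<d. h $$ (j, t) * Y $$ (t, k)) * c k = (if k = j then c k else 0)"
      using \<open>k \<in> {..<n}\<close> c(1) n_le_d by simp
  qed simp
  also have "\<dots> = c j"
    using c(1) by simp
  finally have "c j \<in> m"
    using mem by (metis (no_types, lifting) lessThan_iff mult_mem sum_mem)
  with c(2) show False by simp
qed

text \<open>Adding row \<open>i\<close> to the rows \<open>s \<ge> n\<close> maps the event below to pairwise disjoint events of at
  least the same probability.\<close>

lemma measure_unit_above_le:
  assumes i: "i < n"
  shows "real (d - n) * measure Q {Y \<in> degenerate_event c. column_comb c Y i \<notin> m} \<le> 1"
proof -
  interpret prob_space Q by (rule prob_Q)
  define F where "F = {Y \<in> degenerate_event c. column_comb c Y i \<notin> m}"
  \<comment> \<open>On \<open>G s\<close> the row \<open>s\<close> is the only lower row whose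
    combination lies outside \<open>m\<close>; this makes the sets disjoint.\<close>
  define G where "G s = {Y \<in> carrier (GL d). \<forall>t\<in>{n..<d} - {s}. column_comb c Y t \<in> m} -
      {Y \<in> carrier (GL d). column_comb c Y s \<in> m}" for s
  have G_sets: "G s \<in> sets Q" if "s < d" for s
    unfolding G_def using that by (intro sets.Diff column_comb_Ball_sets column_comb_sets) auto
  have FG: "measure Q F \<le> measure Q (G s)" if s: "s \<in> {n..<d}" for s
  proof -
    let ?g = "addrow_mat d 1 s i :: 'a mat"
    have g: "?g \<in> carrier (GL d)"
      using s i by (intro addrow_mat_GL) auto
    have comb: "column_comb c (?g * Y) t = (if t = s then column_comb c Y i + column_comb c Y s else column_comb c Y t)"
      if "Y \<in> carrier (GL d)" "t < d" for Y t
      using that s i n_le_d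
      by (auto simp: addrow_mat_mult_index carrier_GL distrib_right sum.distrib[symmetric] intro!: sum.cong)
    have "F \<subseteq> {Y \<in> carrier (GL d). ?g * Y \<in> G s}"
    proof
      fix Y assume "Y \<in> F"
      then have Y: "Y \<in> carrier (GL d)" "\<And>t. t \<in> {n..<d} \<Longrightarrow> column_comb c Y t \<in> m" "column_comb c Y i \<notin> m"
        by (auto simp: F_def degenerate_event_def)
      have "column_comb c Y i + column_comb c Y s \<notin> m"
        using mem_cong[of "column_comb c Y i + column_comb c Y s" "column_comb c Y i"] Y(2)[OF s] Y(3) by simp
      then have "column_comb c (?g * Y) s \<notin> m"
        using s by (simp add: comb[OF Y(1)])
      moreover have "column_comb c (?g * Y) t \<in> m" if "t \<in> {n..<d} - {s}" for t
        using that Y(2) by (simp add: comb[OF Y(1)])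
      ultimately show "Y \<in> {Y \<in> carrier (GL d). ?g * Y \<in> G s}"
        using Y(1) GL_mult_closed[OF g Y(1)] by (simp add: G_def)
    qed
    moreover have "{Y \<in> carrier (GL d). ?g * Y \<in> G s} \<in> sets Q"
      using measurable_sets[OF normalized_haar_distr_mult(1)[OF haar g] G_sets[of s]] s
      by (simp add: space_Q vimage_def Int_def conj_commute)
    ultimately have "measure Q F \<le> measure Q {Y \<in> carrier (GL d). ?g * Y \<in> G s}"
      by (rule finite_measure_mono)
    then show ?thesis
      using measure_GL_mult[OF g G_sets[of s]] s by simp
  qed
  have "disjoint_family_on G {n..<d}"
    unfolding disjoint_family_on_def G_def by blast
  then have "(\<Sum>s\<in>{n..<d}. measure Q (G s)) = measure Q (\<Union>s\<in>{n..<d}. G s)"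
    using G_sets by (intro finite_measure_finite_Union[symmetric]) auto
  then have "(\<Sum>s\<in>{n..<d}. measure Q (G s)) \<le> 1"
    by simp
  moreover have "(\<Sum>s\<in>{n..<d}. measure Q F) \<le> (\<Sum>s\<in>{n..<d}. measure Q (G s))"
    using FG by (rule sum_mono)
  ultimately show ?thesis
    by (simp add: F_def)
qed

text \<open>Some row combination is a unit, and it must sit in one of the first \<open>n\<close>
  rows; each of these \<open>n\<close> cases has probability at most
  \<open>1 / (d - n)\<close>.\<close>

lemma measure_degenerate_event_le:
  assumes c: "j < n" "c j \<notin> m" and d: "n < d"
  shows "measure Q (degenerate_event c) \<le> real n / real (d - n)"
proof -
  interpret prob_space Q by (rule prob_Q)
  let ?F = "\<lambda>i. {Y \<in> degenerate_event c. column_comb c Y i \<notin> m}"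
  have "?F i = degenerate_event c - {Y \<in> carrier (GL d). column_comb c Y i \<in> m}" for i
    by (auto simp: degenerate_event_def)
  then have F_sets: "?F i \<in> sets Q" if "i < n" for i
    using that d degenerate_event_sets column_comb_sets[of i c] by auto
  have "degenerate_event c \<subseteq> (\<Union>i<n. ?F i)"
  proof
    fix Y assume Y: "Y \<in> degenerate_event c"
    then obtain t where "t < d" "column_comb c Y t \<notin> m"
      using ex_unit_column_comb[of Y j c] c by (auto simp: degenerate_event_def)
    moreover from this Y have "t < n"
      by (auto simp: degenerate_event_def not_less[symmetric])
    ultimately show "Y \<in> (\<Union>i<n. ?F i)"
      using Y by blast
  qed
  then have "measure Q (degenerate_event c) \<le> measure Q (\<Union>i<n. ?F i)"
    using F_sets by (intro finite_measure_mono sets.finite_UN) auto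
  also have "\<dots> \<le> (\<Sum>i<n. measure Q (?F i))"
    using F_sets by (intro finite_measure_subadditive_finite) auto
  also have "\<dots> \<le> (\<Sum>i<n. 1 / real (d - n))"
    using measure_unit_above_le d by (intro sum_mono) (simp add: field_simps)
  finally show ?thesis by simp
qed

text \<open>Rounding a vector to representatives in \<open>R\<close> changes its combinations only
  by elements of \<open>m\<close>, so excluding finitely many \<open>c\<close> excludes all. The
  lower part of \<open>Y\<close> then has an exact left inverse.\<close>

lemma pivot_or_degenerate:
  assumes R: "\<And>a. \<exists>r\<in>R. a - r \<in> m" and Y: "Y \<in> carrier (GL d)"
    and nondeg: "\<And>c j. c \<in> {..<n} \<rightarrow>\<^sub>E R \<Longrightarrow> j < n \<Longrightarrow> c j \<notin> m \<Longrightarrow> Y \<notin> degenerate_event c"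
  shows "\<exists>l \<in> {..<n} \<times> {n..<d} \<rightarrow>\<^sub>E R. Y \<in> pivot_event l"
proof -
  obtain r where r: "\<And>a. r a \<in> R" "\<And>a. a - r a \<in> m"
    using R by metis
  have "\<exists>t\<in>{n..<d}. column_comb c Y t \<notin> m" if c: "\<exists>j<n. c j \<notin> m" for c
  proof -
    define c' where "c' = (\<lambda>j\<in>{..<n}. r (c j))"
    obtain j where j: "j < n" "c j \<notin> m"
      using c by blast
    then have "c' j \<notin> m"
      using mem_cong[OF r(2)] by (simp add: c'_def)
    then have "Y \<notin> degenerate_event c'"
      using nondeg[of c' j] j(1) r(1) by (simp add: c'_def)
    then obtain t where t: "t \<in> {n..<d}" "column_comb c' Y t \<notin> m"
      using Y by (auto simp: degenerate_event_def)
    have "column_comb c Y t - column_comb c' Y t = (\<Sum>j<n. Y $$ (t, j) * (c j - r (c j)))"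
      by (simp add: c'_def sum_subtractf[symmetric] right_diff_distrib)
    also have "\<dots> \<in> m"
      by (intro sum_mem mult_mem r(2))
    finally show ?thesis
      using t mem_cong by blast
  qed
  from left_inverse_of_unimodular[of m "{n..<d}" n "\<lambda>t j. Y $$ (t, j)", OF unit zero_mem one_not_mem finite_atLeastLessThan this]
  obtain L where L: "\<forall>i<n. \<forall>j<n. (\<Sum>t\<in>{n..<d}. L i t * Y $$ (t, j)) = (if i = j then 1 else 0)"
    by blast
  \<comment> \<open>Rounding the exact left inverse to \<open>R\<close> keeps the congruence and
    places \<open>l\<close> in a finite set.\<close>
  define l where "l = restrict (\<lambda>(i, t). r (L i t)) ({..<n} \<times> {n..<d})"
  have "(\<Sum>t\<in>{n..<d}. l (i, t) * Y $$ (t, j)) - (if i = j then 1 else 0) \<in> m" if ij: "i < n" "j < n" for i j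
  proof -
    have "(if i = j then 1 else 0) - (\<Sum>t\<in>{n..<d}. l (i, t) * Y $$ (t, j)) =
        (\<Sum>t\<in>{n..<d}. L i t * Y $$ (t, j)) - (\<Sum>t\<in>{n..<d}. l (i, t) * Y $$ (t, j))"
      using L ij by simp
    also have "\<dots> = (\<Sum>t\<in>{n..<d}. Y $$ (t, j) * (L i t - r (L i t)))"
      unfolding sum_subtractf[symmetric] using ij by (intro sum.cong) (auto simp: l_def algebra_simps)
    also have "\<dots> \<in> m"
      by (intro sum_mem mult_mem r(2))
    finally show ?thesis
      using uminus_mem by fastforce
  qed
  then have "Y \<in> pivot_event l"
    using Y by (simp add: pivot_event_def)
  moreover have "l \<in> {..<n} \<times> {n..<d} \<rightarrow>\<^sub>E R"
    using r(1) by (auto simp: l_def)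
  ultimately show ?thesis by blast
qed

section \<open>Comparison of the law of the corner with the uniform measure\<close>

lemma integrable_mat_entries:
  assumes F: "continuous_map (entry_space n) euclideanreal F"
  shows "integrable Q (\<lambda>Y. F (mat_entries n Y))"
proof -
  interpret prob_space Q by (rule prob_Q)
  obtain B where B: "\<And>z. z \<in> topspace (entry_space n) \<Longrightarrow> norm (F z) \<le> B"
    using bounded_of_continuous_map[OF compact_entry_space F] unfolding bounded_iff by blast
  have "(\<lambda>Y. F (mat_entries n Y)) \<in> borel_measurable Q"
    using borel_measurable_Q[OF continuous_map_compose[OF continuous_map_GL_mat_entries F]] by (simp add: o_def)
  then show ?thesis
    using B[OF mat_entries_in] by (intro integrable_const_bound[of _ B]) auto
qed

lemma integrable_indicator_mat_entries:
  assumes F: "continuous_map (entry_space n) euclideanreal F" and G: "G \<in> sets Q"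
  shows "integrable Q (\<lambda>Y. indicator G Y * F (mat_entries n Y))"
  using integrable_real_mult_indicator[OF G integrable_mat_entries[OF F]]
  by (simp only: mult.commute[of "indicator G _"])

text \<open>The pivot events overlap. Each new one is first reduced by the union of the earlier
  ones; the rest is still shear invariant, so the uniformity on it persists and the pieces add
  up.\<close>

lemma integral_UN_pivot:
  assumes F: "continuous_map (entry_space n) euclideanreal F" and A: "finite A"
  shows "(\<integral>Y. indicator (\<Union>l\<in>A. pivot_event l) Y * F (mat_entries n Y) \<partial>Q) =
    measure Q (\<Union>l\<in>A. pivot_event l) * (\<integral>z. F z \<partial>entry_measure)"
  using A
proof induction
  case empty
  then show ?case by simp
next
  case (insert l A)
  interpret prob_space Q by (rule prob_Q)
  let ?U = "\<Union>l\<in>A. pivot_event l"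
  have U: "?U \<in> sets Q"
    using insert.hyps(1) pivot_event_sets by (intro sets.finite_UN) auto
  have D: "pivot_event l - ?U \<in> sets Q"
    using U pivot_event_sets by auto
  have UN: "(\<Union>l\<in>insert l A. pivot_event l) = ?U \<union> (pivot_event l - ?U)"
    by blast
  have "(\<integral>Y. indicator (\<Union>l\<in>insert l A. pivot_event l) Y * F (mat_entries n Y) \<partial>Q) =
      (\<integral>Y. indicator ?U Y * F (mat_entries n Y) + indicator (pivot_event l - ?U) Y * F (mat_entries n Y) \<partial>Q)"
    unfolding UN by (intro Bochner_Integration.integral_cong) (auto simp: indicator_def)
  also have "\<dots> = (\<integral>Y. indicator ?U Y * F (mat_entries n Y) \<partial>Q) +
      (\<integral>Y. indicator (pivot_event l - ?U) Y * F (mat_entries n Y) \<partial>Q)"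
    by (intro Bochner_Integration.integral_add integrable_indicator_mat_entries F U D)
  also have "(\<integral>Y. indicator (pivot_event l - ?U) Y * F (mat_entries n Y) \<partial>Q) =
      measure Q (pivot_event l - ?U) * (\<integral>z. F z \<partial>entry_measure)"
    by (rule integral_pivot[OF F D])
      (auto intro!: shear_invariant_Diff shear_invariant_UN shear_invariant_pivot_event)
  finally have int: "(\<integral>Y. indicator (\<Union>l\<in>insert l A. pivot_event l) Y * F (mat_entries n Y) \<partial>Q) =
      (measure Q ?U + measure Q (pivot_event l - ?U)) * (\<integral>z. F z \<partial>entry_measure)"
    unfolding insert.IH by (simp only: distrib_right)
  have "measure Q (\<Union>l\<in>insert l A. pivot_event l) = measure Q ?U + measure Q (pivot_event l - ?U)"
    unfolding UN by (intro finite_measure_Union U D) auto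
  with int show ?case by (simp only:)
qed

text \<open>The centred function \<open>?H\<close> integrates to 0 over the union \<open>?P\<close>
  of the pivot events and is bounded by \<open>2 * B\<close> elsewhere. The complement of
  \<open>?P\<close> is covered by the degenerate events of vectors over \<open>R\<close>, each of
  probability at most \<open>n / (d - n)\<close>.\<close>

lemma corner_integral_close:
  assumes F: "continuous_map (entry_space n) euclideanreal F"
    and B: "\<And>z. z \<in> topspace (entry_space n) \<Longrightarrow> \<bar>F z\<bar> \<le> B"
    and R: "finite R" "\<And>a. \<exists>r\<in>R. a - r \<in> m" and d: "n < d"
  shows "\<bar>(\<integral>Y. F (mat_entries n Y) \<partial>Q) - (\<integral>z. F z \<partial>entry_measure)\<bar> \<le>
    2 * B * (real (card ({..<n} \<rightarrow>\<^sub>E R)) * (real n / real (d - n)))"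
proof -
  interpret prob_space Q by (rule prob_Q)
  interpret E: prob_space entry_measure by (rule prob_entry_measure)
  let ?I = "\<integral>z. F z \<partial>entry_measure"
  let ?H = "\<lambda>z. F z - ?I"
  \<comment> \<open>This set grows with \<open>d\<close>, but its size does not enter the estimate;
    the vectors in \<open>?C\<close>, which are counted, have length \<open>n\<close> for every
    \<open>d\<close>.\<close>
  let ?L = "{..<n} \<times> {n..<d} \<rightarrow>\<^sub>E R"
  let ?C = "{c \<in> {..<n} \<rightarrow>\<^sub>E R. \<exists>j<n. c j \<notin> m}"
  let ?P = "\<Union>l\<in>?L. pivot_event l"
  have fin: "finite ?L" "finite ({..<n} \<rightarrow>\<^sub>E R)"
    using R(1) by (auto intro!: finite_PiE)
  have H: "continuous_map (entry_space n) euclideanreal ?H"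
    by (intro continuous_map_diff F) simp
  have F_int: "integrable entry_measure F"
    by (rule integrable_of_continuous_map[OF base_entry_measure compact_entry_space E.finite_measure_axioms F])
  have P: "?P \<in> sets Q"
    using fin(1) pivot_event_sets by (intro sets.finite_UN) auto
  have "(\<integral>z. ?H z \<partial>entry_measure) = 0"
    using F_int by (simp add: E.prob_space)
  then have P0: "(\<integral>Y. indicator ?P Y * ?H (mat_entries n Y) \<partial>Q) = 0"
    using integral_UN_pivot[OF H fin(1)] by simp
  have cP: "space Q - ?P \<in> sets Q"
    using P by auto
  have B0: "\<bar>?I\<bar> \<le> B"
  proof -
    have "\<bar>?I\<bar> \<le> (\<integral>z. \<bar>F z\<bar> \<partial>entry_measure)"
      by (rule integral_abs_bound)
    also have "\<dots> \<le> (\<integral>z. B \<partial>entry_measure)"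
      using F_int B by (intro integral_mono) (auto simp: space_entry_measure)
    finally show ?thesis
      by (simp add: E.prob_space)
  qed
  have H_le: "\<bar>?H (mat_entries n Y)\<bar> \<le> 2 * B" for Y
    using B[OF mat_entries_in, of Y] B0 by linarith
  have "(\<integral>Y. F (mat_entries n Y) \<partial>Q) - ?I = (\<integral>Y. ?H (mat_entries n Y) \<partial>Q)"
    using integrable_mat_entries[OF F] by (simp add: prob_space)
  also have "\<dots> = (\<integral>Y. indicator ?P Y * ?H (mat_entries n Y) + indicator (space Q - ?P) Y * ?H (mat_entries n Y) \<partial>Q)"
    by (intro Bochner_Integration.integral_cong) (simp_all add: indicator_def)
  also have "\<dots> = (\<integral>Y. indicator (space Q - ?P) Y * ?H (mat_entries n Y) \<partial>Q)"
    using P0 by (subst Bochner_Integration.integral_add) (auto intro!: integrable_indicator_mat_entries H P cP)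
  finally have eq: "(\<integral>Y. F (mat_entries n Y) \<partial>Q) - ?I = (\<integral>Y. indicator (space Q - ?P) Y * ?H (mat_entries n Y) \<partial>Q)" .
  have "\<bar>(\<integral>Y. F (mat_entries n Y) \<partial>Q) - ?I\<bar> \<le> (\<integral>Y. \<bar>indicator (space Q - ?P) Y * ?H (mat_entries n Y)\<bar> \<partial>Q)"
    unfolding eq by (rule integral_abs_bound)
  also have "\<dots> \<le> (\<integral>Y. 2 * B * indicator (space Q - ?P) Y \<partial>Q)"
  proof (rule integral_mono)
    show "integrable Q (\<lambda>Y. \<bar>indicator (space Q - ?P) Y * ?H (mat_entries n Y)\<bar>)"
      by (intro integrable_abs integrable_indicator_mat_entries H cP)
    show "integrable Q (\<lambda>Y. 2 * B * indicator (space Q - ?P) Y)"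
      using cP by (intro integrable_mult_right) (simp add: less_top[symmetric])
    show "\<bar>indicator (space Q - ?P) Y * ?H (mat_entries n Y)\<bar> \<le> 2 * B * indicator (space Q - ?P) Y" for Y
      using H_le[of Y] by (simp add: indicator_def)
  qed
  also have "\<dots> = 2 * B * measure Q (space Q - ?P)"
    using cP by (simp add: Int_absorb2)
  finally have le: "\<bar>(\<integral>Y. F (mat_entries n Y) \<partial>Q) - ?I\<bar> \<le> 2 * B * measure Q (space Q - ?P)" .
  have "space Q - ?P \<subseteq> (\<Union>c\<in>?C. degenerate_event c)"
  proof
    fix Y assume Y: "Y \<in> space Q - ?P"
    show "Y \<in> (\<Union>c\<in>?C. degenerate_event c)"
    proof (rule ccontr)
      assume "Y \<notin> (\<Union>c\<in>?C. degenerate_event c)"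
      then have "\<exists>l\<in>?L. Y \<in> pivot_event l"
        using Y by (intro pivot_or_degenerate R(2)) (auto simp: space_Q)
      with Y show False by blast
    qed
  qed
  then have "measure Q (space Q - ?P) \<le> measure Q (\<Union>c\<in>?C. degenerate_event c)"
    using fin(2) degenerate_event_sets by (intro finite_measure_mono sets.finite_UN) auto
  also have "\<dots> \<le> (\<Sum>c\<in>?C. measure Q (degenerate_event c))"
    using fin(2) degenerate_event_sets by (intro finite_measure_subadditive_finite) auto
  also have "\<dots> \<le> (\<Sum>c\<in>?C. real n / real (d - n))"
    using measure_degenerate_event_le[OF _ _ d] by (intro sum_mono) blast
  also have "\<dots> \<le> real (card ({..<n} \<rightarrow>\<^sub>E R)) * (real n / real (d - n))"
    unfolding sum_constant by (intro mult_right_mono of_nat_mono card_mono fin(2)) auto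
  finally have bad: "measure Q (space Q - ?P) \<le> real (card ({..<n} \<rightarrow>\<^sub>E R)) * (real n / real (d - n))" .
  have "0 \<le> 2 * B"
    using B0 abs_ge_zero[of ?I] by linarith
  from order_trans[OF le mult_left_mono[OF bad this]] show ?thesis .
qed

end

section \<open>From the algebraic and measure-theoretic hypotheses to the limit\<close>

text \<open>The one point beyond unfolding is that elements outside the ideal are units: a nonunit
  lies in some maximal ideal, which by uniqueness is \<open>\<mm>\<close>.\<close>

lemma compact_local_ring_of_unique_maximalideal:
  fixes \<mm> :: "'a::{comm_ring_1, t2_space, topological_monoid_add, topological_semigroup_mult} set"
  assumes compact: "compact (UNIV :: 'a set)"
    and maximal: "maximalideal \<mm> (ring_of_type_algebra :: 'a ring)"
    and unique_maximal: "\<And>I. maximalideal I (ring_of_type_algebra :: 'a ring) \<Longrightarrow> I = \<mm>"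
    and closed: "closed \<mm>"
  shows "compact_local_ring \<mm>"
proof -
  let ?R = "ring_of_type_algebra :: 'a ring"
  interpret R: cring ?R by (rule cring_from_type_algebra)
  interpret I: maximalideal \<mm> ?R by fact
  show ?thesis
  proof
    show "0 \<in> \<mm>"
      using I.additive_subgroup_axioms additive_subgroup.zero_closed by (fastforce simp: ring_of_type_algebra_def)
    show "a + b \<in> \<mm>" if "a \<in> \<mm>" "b \<in> \<mm>" for a b
      using additive_subgroup.a_closed[OF I.additive_subgroup_axioms that] by (simp add: ring_of_type_algebra_def)
    show "a * b \<in> \<mm>" if "b \<in> \<mm>" for a b
      using I.I_l_closed[OF that, of a] by (simp add: ring_of_type_algebra_def)
    show "1 \<notin> \<mm>"
      using I.I_notcarr I.one_imp_carrier by (auto simp: ring_of_type_algebra_def)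
    show "a dvd 1" if a: "a \<notin> \<mm>" for a
    proof (rule ccontr)
      assume "\<not> a dvd 1"
      then have "a \<notin> Units ?R"
        by (auto simp: Units_def ring_of_type_algebra_def dvd_def mult.commute)
      then obtain M where "maximalideal M ?R" "a \<in> M"
        using R.ex_maximalideal_containing[of a] by (auto simp: ring_of_type_algebra_def)
      with unique_maximal a show False by blast
    qed
  qed (fact compact closed)+
qed

text \<open>Transfers integrals from the regular Borel extension to \<open>PiM\<close>. The
  integrand has to be measurable for the possibly smaller product \<sigma>-algebra, which holds for
  continuous functions on the compact array space.\<close>

lemma integral_mat_product_measure:
  fixes N :: "'a::{topological_space} measure" and f :: "'a mat \<Rightarrow> real"
  assumes \<rho>: "is_mat_product_measure n N \<rho>" and N: "sets N = sets borel"
    and F: "(\<lambda>z. f (mat n n z)) \<in> borel_measurable (\<Pi>\<^sub>M ij\<in>square n. N)"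
  shows "(\<integral>Y. f Y \<partial>\<rho>) = (\<integral>z. f (mat n n z) \<partial>(\<Pi>\<^sub>M ij\<in>square n. N))"
proof -
  let ?M = "\<Pi>\<^sub>M ij\<in>square n. N"
  have sets: "sets \<rho> = sets (borel_on (mat_topology n))" and d: "distr \<rho> ?M (mat_entries n) = ?M"
    using \<rho> by (auto simp: is_mat_product_measure_def regular_borel_prob_def)
  have space: "space \<rho> = carrier_mat n n"
    using sets_eq_imp_space_eq[OF sets] by (simp add: space_borel_on topspace_mat_topology)
  have "(\<lambda>Y. Y $$ (i, j)) \<in> \<rho> \<rightarrow>\<^sub>M N" if "i < n" "j < n" for i j
    using continuous_map_borel_on_measurable[OF continuous_map_mat_index[OF continuous_map_id that, unfolded id_apply]]
      measurable_cong_sets[OF sets trans[OF N sets_borel_on_euclidean[symmetric]]] by blast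
  then have meas: "mat_entries n \<in> \<rho> \<rightarrow>\<^sub>M ?M"
    unfolding mat_entries_def by (intro measurable_restrict) auto
  have "(\<integral>Y. f Y \<partial>\<rho>) = (\<integral>Y. f (mat n n (mat_entries n Y)) \<partial>\<rho>)"
  proof (rule Bochner_Integration.integral_cong)
    fix Y assume "Y \<in> space \<rho>"
    then have "mat n n (mat_entries n Y) = Y"
      unfolding space by (intro eq_matI) (auto simp: mat_entries_def)
    then show "f Y = f (mat n n (mat_entries n Y))" by simp
  qed simp
  also have "\<dots> = (\<integral>z. f (mat n n z) \<partial>distr \<rho> ?M (mat_entries n))"
    by (rule integral_distr[OF meas F, symmetric])
  finally show ?thesis
    unfolding d .
qed

lemma continuous_map_mat_of_entries: "continuous_map (entry_space n) (mat_topology n) (mat n n)"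
  by (intro continuous_map_into_mat_topology) (auto intro: continuous_map_entry[OF continuous_map_id, unfolded id_apply])

lemma corner_eq: "corner n Y = mat n n (mat_entries n Y)"
  by (rule eq_matI) (auto simp: corner_def mat_entries_def)

theorem theorem4p5:
  fixes \<mm> :: "'a::{comm_ring_1, t2_space, topological_monoid_add, topological_semigroup_mult} set"
    and S :: nat
    and unif :: "'a measure"
    and unifS :: "'a mat measure"
    and P :: "nat \<Rightarrow> 'w measure"
    and Y :: "nat \<Rightarrow> 'w \<Rightarrow> 'a mat"
  assumes compact: "compact (UNIV :: 'a set)"
    and maximal: "maximalideal \<mm> (ring_of_type_algebra :: 'a ring)"
    and unique_maximal: "\<And>I. maximalideal I (ring_of_type_algebra :: 'a ring) \<Longrightarrow> I = \<mm>"
    and closed_maximal: "closed \<mm>"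
    and S_pos: "S > 0"
    and haar: "normalized_haar_measure (add_monoid (ring_of_type_algebra :: 'a ring)) euclidean unif"
    and product: "is_mat_product_measure S unif unifS"
    and prob: "\<And>N. N \<ge> S \<Longrightarrow> prob_space (P N)"
    and random: "\<And>N. N \<ge> S \<Longrightarrow> Y N \<in> P N \<rightarrow>\<^sub>M borel_on (GL_topology N)"
    and distributed: "\<And>N. N \<ge> S \<Longrightarrow>
       normalized_haar_measure (GL N) (GL_topology N) (distr (P N) (borel_on (GL_topology N)) (Y N))"
  shows "converges_weakly (mat_topology S)
           (\<lambda>N. distr (P N) (borel_on (mat_topology S)) (\<lambda>\<omega>. corner S (Y N \<omega>))) unifS"
proof -
  interpret compact_local_ring \<mm>
    by (rule compact_local_ring_of_unique_maximalideal[OF compact maximal unique_maximal closed_maximal])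
  have sets_unif: "sets unif = sets borel" and prob_unif: "prob_space unif"
    using haar by (auto simp: normalized_haar_measure_def regular_borel_prob_def sets_borel_on_euclidean)
  have translate: "emeasure unif ((+) g ` A) = emeasure unif A" if "A \<in> sets unif" for g A
    using haar that by (simp add: normalized_haar_measure_def ring_of_type_algebra_def)
  interpret compact_local_ring_uniform \<mm> unif S
    by (intro compact_local_ring_uniform.intro compact_local_ring_axioms
        compact_local_ring_uniform_axioms.intro sets_unif prob_unif translate)
  show ?thesis
    unfolding converges_weakly_def
  proof (intro allI impI)
    fix f :: "'a mat \<Rightarrow> real"
    assume "continuous_map (mat_topology S) euclideanreal f \<and> bounded (f ` topspace (mat_topology S))"
    then have f: "continuous_map (mat_topology S) euclideanreal f" by simp
    let ?F = "\<lambda>z. f (mat S S z)"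
    have F: "continuous_map (entry_space S) euclideanreal ?F"
      using continuous_map_compose[OF continuous_map_mat_of_entries f] by (simp add: o_def)
    obtain B where B: "\<And>z. z \<in> topspace (entry_space S) \<Longrightarrow> \<bar>?F z\<bar> \<le> B"
      using bounded_of_continuous_map[OF compact_entry_space F] by (auto simp: bounded_iff)
    obtain R where R: "finite R" "\<And>a. \<exists>r\<in>R. a - r \<in> \<mm>"
      using finite_residues by blast
    let ?D = "\<lambda>N. distr (P N) (borel_on (mat_topology S)) (\<lambda>\<omega>. corner S (Y N \<omega>))"
    have lim: "(\<integral>x. f x \<partial>unifS) = (\<integral>z. ?F z \<partial>entry_measure)"
      by (rule integral_mat_product_measure[OF product sets_unif
            borel_measurable_of_continuous_map[OF base_entry_measure compact_entry_space F]])
    \<comment> \<open>The bound divides by \<open>N - S\<close>, so \<open>N = S\<close> is left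
      out; this does not affect the limit.\<close>
    have close: "\<bar>(\<integral>x. f x \<partial>?D N) - (\<integral>x. f x \<partial>unifS)\<bar> \<le>
        2 * B * (real (card ({..<S} \<rightarrow>\<^sub>E R)) * (real S / real (N - S)))" if N: "S < N" for N
    proof -
      let ?Q = "distr (P N) (borel_on (GL_topology N)) (Y N)"
      interpret compact_local_ring_GL \<mm> unif S N ?Q
        by (intro compact_local_ring_GL.intro compact_local_ring_uniform_axioms
            compact_local_ring_GL_axioms.intro less_imp_le[OF N] distributed)
      have Y: "Y N \<in> P N \<rightarrow>\<^sub>M borel_on (GL_topology N)"
        using random N by simp
      have "continuous_map (GL_topology N) (mat_topology S) (corner S)"
        unfolding corner_eq
        using continuous_map_compose[OF continuous_map_GL_mat_entries continuous_map_mat_of_entries]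
        by (simp add: o_def)
      then have corner: "corner S \<in> borel_on (GL_topology N) \<rightarrow>\<^sub>M borel_on (mat_topology S)"
        by (rule continuous_map_borel_on_measurable)
      have f_meas: "f \<in> borel_measurable (borel_on (mat_topology S))"
        by (rule continuous_map_real_borel_on_measurable[OF f])
      have "(\<integral>x. f x \<partial>?D N) = (\<integral>\<omega>. f (corner S (Y N \<omega>)) \<partial>P N)"
        by (rule integral_distr[OF measurable_compose[OF Y corner] f_meas])
      also have "\<dots> = (\<integral>M. f (corner S M) \<partial>?Q)"
        by (rule integral_distr[OF Y measurable_compose[OF corner f_meas], symmetric])
      finally have "(\<integral>x. f x \<partial>?D N) = (\<integral>M. ?F (mat_entries S M) \<partial>?Q)"
        by (simp only: corner_eq)
      with corner_integral_close[OF F B R N] lim show ?thesis by simp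
    qed
    have "(\<lambda>N. (\<integral>x. f x \<partial>?D N) - (\<integral>x. f x \<partial>unifS)) \<longlonglongrightarrow> 0"
    proof (rule Lim_null_comparison)
      show "\<forall>\<^sub>F N in sequentially. norm ((\<integral>x. f x \<partial>?D N) - (\<integral>x. f x \<partial>unifS)) \<le>
          2 * B * (real (card ({..<S} \<rightarrow>\<^sub>E R)) * (real S / real (N - S)))"
        using eventually_gt_at_top[of S] by eventually_elim (use close in simp)
      have "(\<lambda>N. real S / real (N - S)) \<longlonglongrightarrow> 0"
        \<comment> \<open>Shifting the index by \<open>S\<close> turns the truncated difference
          \<open>N - S\<close> into \<open>N\<close>.\<close>
        by (rule LIMSEQ_offset[where k = S]) (simp add: lim_const_over_n)
      then show "(\<lambda>N. 2 * B * (real (card ({..<S} \<rightarrow>\<^sub>E R)) * (real S / real (N - S)))) \<longlonglongrightarrow> 0"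
        by (intro tendsto_mult_right_zero)
    qed
    then show "(\<lambda>N. \<integral>x. f x \<partial>?D N) \<longlonglongrightarrow> (\<integral>x. f x \<partial>unifS)"
      by (simp add: LIM_zero_iff)
  qed
qed

end
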